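(* Let $(\Omega,\mathsf{F},\mathbb{P})$ and $(E,\mathsf{E},\mu)$ be probability spaces, with $(E,\mathsf{E},\mu)$ complete, and let $\mathcal{H}$ be a separable Hilbert space. Let $(\xi_i)_{i\ge1}$ be an i.i.d. sequence of random variables $\xi_i:\Omega\to E$ with distribution $\mu$. Let $f:E\times\mathcal{H}\to(-\infty,+\infty]$ be a proper normal convex integrand which is $L^1$-Lipschitz, and suppose there exists $u_0\in\mathcal{H}$ such that $f(\cdot,u_0)\in L^1(E,\mathbb{R},\mu)$. Let $S_t(x)$ denote the gradient flow semigroup associated with $x\mapsto\int f(e,x)\,d\mu(e)$. Then there exists a set $\Omega'\subseteq\Omega$ with $\mathbb{P}(\Omega')=1$ such that for every $\omega\in\Omega'$, every $t\ge0$ and every $x\in\mathcal{H}$: \[ S_t(x)=\lim_{n\to\infty}\left(\mathrm{prox}_{\frac{t}{n^2}f(\xi_n(\omega),\cdot)}\circ\dots\circ\mathrm{prox}_{\frac{t}{n^2}f(\xi_1(\omega),\cdot)}\right)^{(n)}(x). \] In particular, for every $t\ge0$ and every $x\in\mathcal{H}$, the limit $S_t(x)=\lim_{n\to\infty}\left(\mathrm{prox}_{\frac{t}{n^2}f(\xi_n,\cdot)}\circ\dots\circ\mathrm{prox}_{\frac{t}{n^2}f(\xi_1,\cdot)}\right)^{(n)}(x)$ holds $\mathbb{P}$-almost surely.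
   Context: Let $d(x,y)=\|x-y\|$. $f:E\times\mathcal{H}\to(-\infty,+\infty]$ is a normal integrand if $f(e,\cdot)$ is lower-semicontinuous for all $e\in E$ and the set-valued map $e\mapsto\{(x,\alpha)\in\mathcal{H}\times\mathbb{R}\mid f(e,x)\le\alpha\}$ is measurable (for every closed set $C$, the set of $e$ whose image meets $C$ is in $\mathsf{E}$); for complete $(E,\mathsf{E},\mu)$ the measurability can equivalently be replaced by $\mathsf{E}\otimes\mathsf{B}(\mathcal{H})$-measurability of $f$. It is a normal convex integrand if moreover every $f(e,\cdot)$ is convex, and proper if every $f(e,\cdot)$ is proper. $f$ is $L^1$-Lipschitz if there is $L\in L^1(E,(0,\infty),\mu)$ such that $|f(e,x)-f(e,y)|\le L(e)d(x,y)$ for all $x,y\in\mathcal{H}$ and $e\in E$. For $h:\mathcal{H}\to(-\infty,+\infty]$ proper, convex and lower-semicontinuous and $\lambda>0$, $\mathrm{prox}_{\lambda h}(x)=\mathrm{argmin}_{y\in\mathcal{H}}\{h(y)+\frac1{2\lambda}d^2(x,y)\}$, and $\mathrm{prox}_{0\cdot h}$ is the identity. The gradient flow semigroup associated with $h$ is $S_t(x)=\lim_{k\to\infty}(\mathrm{prox}_{\frac tk h})^{(k)}(x)$ for $t>0$ and $S_0(x)=x$. $Q^{(n)}$ denotes the $n$-fold iterate of a map $Q$. *)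

theory Defs
  imports "HOL-Probability.Probability"
begin

text \<open>
  Functions with values in \<open>(-\<infinity>, +\<infinity>]\<close> are modelled as \<^typ>\<open>ereal\<close>-valued functions together
  with the explicit requirement that \<open>-\<infinity>\<close> is not attained.
\<close>

definition proper_fun :: "('h \<Rightarrow> ereal) \<Rightarrow> bool" where
  "proper_fun h \<longleftrightarrow> (\<forall>x. h x \<noteq> -\<infinity>) \<and> (\<exists>x. h x \<noteq> \<infinity>)"

definition lsc_fun :: "('h::topological_space \<Rightarrow> ereal) \<Rightarrow> bool" where
  "lsc_fun h \<longleftrightarrow> (\<forall>x. h x \<le> Liminf (at x) h)"

definition convex_fun :: "('h::real_vector \<Rightarrow> ereal) \<Rightarrow> bool" where
  "convex_fun h \<longleftrightarrow> (\<forall>x y. \<forall>a\<in>{0<..<1}.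
     h (a *\<^sub>R x + (1 - a) *\<^sub>R y) \<le> ereal a * h x + ereal (1 - a) * h y)"

definition epi :: "('h \<Rightarrow> ereal) \<Rightarrow> ('h \<times> real) set" where
  "epi h = {(x, \<alpha>). h x \<le> ereal \<alpha>}"

definition measurable_set_valued ::
    "'e measure \<Rightarrow> ('e \<Rightarrow> 'b::topological_space set) \<Rightarrow> bool" where
  "measurable_set_valued M F \<longleftrightarrow>
     (\<forall>C. closed C \<longrightarrow> {e \<in> space M. F e \<inter> C \<noteq> {}} \<in> sets M)"

definition normal_integrand ::
    "'e measure \<Rightarrow> ('e \<Rightarrow> 'h::topological_space \<Rightarrow> ereal) \<Rightarrow> bool" where
  "normal_integrand M f \<longleftrightarrow>
     (\<forall>e\<in>space M. \<forall>x. f e x \<noteq> -\<infinity>) \<and>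
     (\<forall>e\<in>space M. lsc_fun (f e)) \<and>
     measurable_set_valued M (\<lambda>e. epi (f e))"

definition normal_convex_integrand ::
    "'e measure \<Rightarrow> ('e \<Rightarrow> 'h::real_normed_vector \<Rightarrow> ereal) \<Rightarrow> bool" where
  "normal_convex_integrand M f \<longleftrightarrow>
     normal_integrand M f \<and> (\<forall>e\<in>space M. convex_fun (f e))"

definition proper_integrand :: "'e measure \<Rightarrow> ('e \<Rightarrow> 'h \<Rightarrow> ereal) \<Rightarrow> bool" where
  "proper_integrand M f \<longleftrightarrow> (\<forall>e\<in>space M. proper_fun (f e))"

text \<open>
  On \<^typ>\<open>ereal\<close> the difference \<open>\<infinity> - \<infinity>\<close> is \<open>\<infinity>\<close>, so the inequality below fails as soon as one of
  the two values is infinite: an \<open>L\<^sup>1\<close>-Lipschitz integrand is real-valued.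
\<close>

definition L1_Lipschitz ::
    "'e measure \<Rightarrow> ('e \<Rightarrow> 'h::metric_space \<Rightarrow> ereal) \<Rightarrow> bool" where
  "L1_Lipschitz M f \<longleftrightarrow>
     (\<exists>L :: 'e \<Rightarrow> real. integrable M L \<and> (\<forall>e\<in>space M. 0 < L e) \<and>
        (\<forall>e\<in>space M. \<forall>x y. \<bar>f e x - f e y\<bar> \<le> ereal (L e * dist x y)))"

text \<open>Membership of an extended-real function in \<open>L\<^sup>1(E, \<real>, \<mu>)\<close>: finite-valued and integrable.\<close>

definition L1_real :: "'e measure \<Rightarrow> ('e \<Rightarrow> ereal) \<Rightarrow> bool" where
  "L1_real M g \<longleftrightarrow>
     (\<forall>e\<in>space M. \<bar>g e\<bar> \<noteq> \<infinity>) \<and> integrable M (\<lambda>e. real_of_ereal (g e))"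

text \<open>
  Integral of an extended-real function as \<open>\<integral> g\<^sup>+ - \<integral> g\<^sup>-\<close>; \<^const>\<open>e2ennreal\<close> sends negative
  arguments to \<open>0\<close>. By \<open>\<infinity> - \<infinity> = \<infinity>\<close>, the integral is \<open>+\<infinity>\<close> whenever \<open>\<integral> g\<^sup>+\<close> is.
\<close>

definition ereal_integral :: "'e measure \<Rightarrow> ('e \<Rightarrow> ereal) \<Rightarrow> ereal" where
  "ereal_integral M g =
     enn2ereal (\<integral>\<^sup>+ e. e2ennreal (g e) \<partial>M) - enn2ereal (\<integral>\<^sup>+ e. e2ennreal (- g e) \<partial>M)"

text \<open>
  For a proper, convex, lower-semicontinuous \<open>h\<close> on a Hilbert space and \<open>r > 0\<close> the minimiser
  exists and is unique, so the choice made by \<^const>\<open>arg_min\<close> is immaterial.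
\<close>

definition prox :: "real \<Rightarrow> ('h::metric_space \<Rightarrow> ereal) \<Rightarrow> 'h \<Rightarrow> 'h" where
  "prox r h x =
     (if r = 0 then x
      else arg_min (\<lambda>y. h y + ereal (1 / (2 * r) * (dist x y)\<^sup>2)) (\<lambda>_. True))"

definition gradient_flow :: "('h::metric_space \<Rightarrow> ereal) \<Rightarrow> real \<Rightarrow> 'h \<Rightarrow> 'h" where
  "gradient_flow h t x =
     (if t = 0 then x else lim (\<lambda>k. (prox (t / real k) h ^^ k) x))"

text \<open>
  \<open>prox_cycle c n g = prox c (g n) \<circ> \<dots> \<circ> prox c (g 1)\<close>: \<^const>\<open>fold\<close> applies the map for the
  head of the list first.
\<close>

definition prox_cycle ::
    "real \<Rightarrow> nat \<Rightarrow> (nat \<Rightarrow> 'h::metric_space \<Rightarrow> ereal) \<Rightarrow> 'h \<Rightarrow> 'h" where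
  "prox_cycle c n g = fold (\<lambda>i. prox c (g i)) [1..<Suc n]"

definition iid_with_law :: "'w measure \<Rightarrow> 'e measure \<Rightarrow> (nat \<Rightarrow> 'w \<Rightarrow> 'e) \<Rightarrow> bool" where
  "iid_with_law P \<mu> \<xi> \<longleftrightarrow>
     prob_space.indep_vars P (\<lambda>_. \<mu>) \<xi> {1..} \<and> (\<forall>i\<ge>1. distr P \<mu> (\<xi> i) = \<mu>)"

end

theory Submission
  imports Defs
begin

text \<open>
  One round of \<open>n\<close> proximal steps of size \<open>t / n\<^sup>2\<close> is, up to \<open>O(1 / n\<^sup>2)\<close> in squared distance, a
  step of size \<open>t / n\<close> satisfying the evolution variational inequality of the empirical mean of the integrands.
  Convexity bounds that mean below by affine functions at test points \<open>z\<close>, whose slopes are averages of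
  measurably selected approximate subgradients of \<open>f(\<xi>\<^sub>i, \<cdot>)\<close> at \<open>z\<close>; these converge by the strong law of
  large numbers, almost surely for all \<open>z\<close> in a countable dense set at once. Finitely many such points
  support a coarse explicit Euler scheme with \<open>m\<close> steps, and the random scheme ends within
  \<open>O(m\<^sup>-\<^sup>1\<^sup>/\<^sup>2)\<close> of its endpoint. The proximal iterates of the integral functional obey the same
  estimate with the same Euler scheme, so both sequences converge to the same limit.

  The strong law is obtained by approximating with simple functions: for indicators it follows from
  Hoeffding's inequality, and the approximation error is controlled by a bound on averages of nonnegative
  functions that loses a factor 2, which is why dyadic times suffice there.
\<close>

subsection \<open>Proximal maps of Lipschitz convex functions\<close>

text \<open>No compactness is available, but the quadratic term makes the objective uniformly
  convex, so every minimising sequence is Cauchy and completeness yields the minimiser.\<close>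

lemma prox_objective_has_minimiser:
  fixes \<phi> :: "'h::{real_inner, banach} \<Rightarrow> real" and x :: 'h
  assumes cvx: "convex_on UNIV \<phi>" and lip: "L-lipschitz_on UNIV \<phi>" and c: "c > 0"
  shows "\<exists>p. \<forall>y. \<phi> p + c * (dist x p)\<^sup>2 \<le> \<phi> y + c * (dist x y)\<^sup>2"
proof -
  define \<Psi> where "\<Psi> y = \<phi> y + c * (dist x y)\<^sup>2" for y
  have L: "0 \<le> L" using lip by (rule lipschitz_on_nonneg)
  \<comment> \<open>The value subtracted is the maximum of \<open>L * s - c * s^2\<close> over
    \<open>s\<close>, found by completing the square.\<close>
  have lower: "\<phi> x - L\<^sup>2 / (4 * c) \<le> \<Psi> y" for y
  proof -
    have "\<phi> x - \<phi> y \<le> L * dist x y"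
      using lipschitz_onD[OF lip, of x y] by (auto simp: dist_real_def)
    moreover have "0 \<le> c * (dist x y - L / (2 * c))\<^sup>2" using c by simp
    moreover have "c * (dist x y - L / (2 * c))\<^sup>2 = c * (dist x y)\<^sup>2 - L * dist x y + L\<^sup>2 / (4 * c)"
      using c by (simp add: power2_eq_square field_simps)
    ultimately show ?thesis unfolding \<Psi>_def by linarith
  qed
  then have bdd: "bdd_below (range \<Psi>)" by (auto simp: bdd_below_def)
  define m where "m = Inf (range \<Psi>)"
  have m_le: "m \<le> \<Psi> y" for y unfolding m_def by (rule cInf_lower) (use bdd in auto)
  have "\<exists>y. \<Psi> y < m + 1 / real (Suc n)" for n
    using cInf_lessD[of "range \<Psi>" "m + 1 / real (Suc n)"] by (auto simp: m_def)
  then obtain y where y: "\<And>n. \<Psi> (y n) < m + 1 / real (Suc n)" by metis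
  \<comment> \<open>The parallelogram identity at the midpoint \<open>q\<close>: two nearly optimal
    points must be close, since \<open>q\<close> cannot fall below the infimum
    \<open>m\<close>.\<close>
  have gap: "c / 4 * (dist a b)\<^sup>2 \<le> (\<Psi> a + \<Psi> b) / 2 - m" for a b
  proof -
    define q where "q = (1/2) *\<^sub>R a + (1/2) *\<^sub>R b"
    have "\<phi> q \<le> (1/2) * \<phi> a + (1/2) * \<phi> b"
      unfolding q_def using convex_onD[OF cvx, of "1/2" a b] by simp
    moreover have "(dist x q)\<^sup>2 = ((dist x a)\<^sup>2 + (dist x b)\<^sup>2) / 2 - (dist a b)\<^sup>2 / 4"
      unfolding q_def dist_norm power2_norm_eq_inner
      by (simp add: inner_simps inner_commute field_simps)
    then have "c * (dist x q)\<^sup>2 = (c * (dist x a)\<^sup>2 + c * (dist x b)\<^sup>2) / 2 - c * ((dist a b)\<^sup>2 / 4)"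
      by (simp add: right_diff_distrib distrib_left)
    ultimately have "\<Psi> q \<le> (\<Psi> a + \<Psi> b) / 2 - c * ((dist a b)\<^sup>2 / 4)"
      unfolding \<Psi>_def by argo
    with m_le[of q] show ?thesis by argo
  qed
  have "Cauchy y"
  proof (rule metric_CauchyI)
    fix e :: real assume e: "e > 0"
    obtain N where N: "1 / real (Suc N) < c / 4 * e\<^sup>2"
      using reals_Archimedean[of "c / 4 * e\<^sup>2"] c e by (auto simp: inverse_eq_divide)
    have "dist (y i) (y j) < e" if "i \<ge> N" "j \<ge> N" for i j
    proof -
      have "1 / real (Suc i) \<le> 1 / real (Suc N)" "1 / real (Suc j) \<le> 1 / real (Suc N)"
        using that by (auto simp: field_simps)
      then have "c / 4 * (dist (y i) (y j))\<^sup>2 < c / 4 * e\<^sup>2"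
        using gap[of "y i" "y j"] y[of i] y[of j] N by argo
      then show ?thesis using c e by (simp add: power_less_imp_less_base)
    qed
    then show "\<exists>M. \<forall>m\<ge>M. \<forall>n\<ge>M. dist (y m) (y n) < e" by blast
  qed
  then obtain p where p: "y \<longlonglongrightarrow> p" by (auto simp: Cauchy_convergent_iff convergent_def)
  have "continuous_on UNIV \<phi>" using lip by (rule lipschitz_on_continuous_on)
  then have "(\<lambda>n. \<phi> (y n)) \<longlonglongrightarrow> \<phi> p"
    using p by (auto intro: continuous_on_tendsto_compose)
  then have "(\<lambda>n. \<Psi> (y n)) \<longlonglongrightarrow> \<Psi> p"
    unfolding \<Psi>_def by (intro tendsto_intros p)
  moreover have "(\<lambda>n. m + 1 / real (Suc n)) \<longlonglongrightarrow> m + 0"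
    using LIMSEQ_inverse_real_of_nat by (intro tendsto_intros) (simp add: inverse_eq_divide)
  ultimately have "\<Psi> p \<le> m + 0"
    by (rule LIMSEQ_le) (use y less_imp_le in blast)
  then show ?thesis using m_le unfolding \<Psi>_def by (metis add_0_right order_trans)
qed

lemma prox_minimises:
  fixes \<phi> :: "'h::{real_inner, banach} \<Rightarrow> real" and x :: 'h
  assumes "convex_on UNIV \<phi>" "L-lipschitz_on UNIV \<phi>" "r > 0"
  defines "p \<equiv> prox r (\<lambda>y. ereal (\<phi> y)) x"
  shows "\<phi> p + (dist x p)\<^sup>2 / (2 * r) \<le> \<phi> y + (dist x y)\<^sup>2 / (2 * r)"
proof -
  let ?\<Psi> = "\<lambda>y. ereal (\<phi> y) + ereal (1 / (2 * r) * (dist x y)\<^sup>2)"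
  obtain q where "\<forall>y. \<phi> q + 1 / (2 * r) * (dist x q)\<^sup>2 \<le> \<phi> y + 1 / (2 * r) * (dist x y)\<^sup>2"
    using prox_objective_has_minimiser[OF assms(1,2), of "1 / (2 * r)" x] \<open>r > 0\<close> by auto
  then have "is_arg_min ?\<Psi> (\<lambda>_. True) q" by (auto simp: is_arg_min_def not_less)
  then have "is_arg_min ?\<Psi> (\<lambda>_. True) p"
    using \<open>r > 0\<close> unfolding p_def prox_def arg_min_def by (simp add: someI)
  then show ?thesis by (auto simp: is_arg_min_def not_less)
qed

text \<open>The optimality condition: \<open>(x - p) / r\<close> is a subgradient of
  \<open>\<phi>\<close> at \<open>p\<close>. It follows by comparing \<open>p\<close> with points of
  the segment towards \<open>y\<close>, dividing by the segment parameter \<open>\<theta>\<close>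
  and letting it tend to 0.\<close>

lemma prox_subgradient:
  fixes \<phi> :: "'h::{real_inner, banach} \<Rightarrow> real" and x :: 'h
  assumes cvx: "convex_on UNIV \<phi>" and lip: "L-lipschitz_on UNIV \<phi>" and r: "r > 0"
  defines "p \<equiv> prox r (\<lambda>y. ereal (\<phi> y)) x"
  shows "\<phi> p + inner (x - p) (y - p) / r \<le> \<phi> y"
proof -
  have step: "\<phi> p - \<phi> y \<le> - (inner (x - p) (y - p) / r) + \<theta> * ((dist p y)\<^sup>2 / (2 * r))"
    if \<theta>: "0 < \<theta>" "\<theta> < 1" for \<theta>
  proof -
    define q where "q = (1 - \<theta>) *\<^sub>R p + \<theta> *\<^sub>R y"
    have "\<phi> q \<le> (1 - \<theta>) * \<phi> p + \<theta> * \<phi> y"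
      unfolding q_def using convex_onD[OF cvx, of \<theta> p y] \<theta> by simp
    moreover have "\<phi> p + (dist x p)\<^sup>2 / (2 * r) \<le> \<phi> q + (dist x q)\<^sup>2 / (2 * r)"
      unfolding p_def by (rule prox_minimises[OF cvx lip r])
    moreover have "(dist x q)\<^sup>2 = (dist x p)\<^sup>2 - 2 * \<theta> * inner (x - p) (y - p) + \<theta>\<^sup>2 * (dist p y)\<^sup>2"
      unfolding q_def dist_norm power2_norm_eq_inner
      by (simp add: inner_simps inner_commute power2_eq_square algebra_simps)
    then have "(dist x q)\<^sup>2 / (2 * r) = (dist x p)\<^sup>2 / (2 * r)
        + (\<theta>\<^sup>2 * (dist p y)\<^sup>2 - 2 * \<theta> * inner (x - p) (y - p)) / (2 * r)"
      by (simp flip: add_divide_distrib)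
    ultimately have "\<theta> * (\<phi> p - \<phi> y) \<le> (\<theta>\<^sup>2 * (dist p y)\<^sup>2 - 2 * \<theta> * inner (x - p) (y - p)) / (2 * r)"
      unfolding left_diff_distrib right_diff_distrib by linarith
    also have "\<dots> = \<theta> * (- (inner (x - p) (y - p) / r) + \<theta> * ((dist p y)\<^sup>2 / (2 * r)))"
      using r by (simp add: field_simps power2_eq_square)
    finally show ?thesis using \<theta> by simp
  qed
  have "((\<lambda>\<theta>. - (inner (x - p) (y - p) / r) + \<theta> * ((dist p y)\<^sup>2 / (2 * r)))
      \<longlongrightarrow> - (inner (x - p) (y - p) / r) + 0 * ((dist p y)\<^sup>2 / (2 * r))) (at_right 0)"
    by (intro tendsto_intros)
  moreover have "eventually (\<lambda>\<theta>. \<phi> p - \<phi> y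
      \<le> - (inner (x - p) (y - p) / r) + \<theta> * ((dist p y)\<^sup>2 / (2 * r))) (at_right 0)"
    using step unfolding eventually_at_right_field by (intro exI[of _ 1]) auto
  ultimately have "\<phi> p - \<phi> y \<le> - (inner (x - p) (y - p) / r) + 0 * ((dist p y)\<^sup>2 / (2 * r))"
    by (rule tendsto_lowerbound) simp
  then show ?thesis by simp
qed

text \<open>The subgradient inequality tested at \<open>y = x\<close> bounds the squared
  displacement over \<open>r\<close> by \<open>\<phi> x - \<phi> p\<close>, which is at most
  \<open>L\<close> times the displacement.\<close>

lemma dist_prox_le:
  fixes \<phi> :: "'h::{real_inner, banach} \<Rightarrow> real" and x :: 'h
  assumes cvx: "convex_on UNIV \<phi>" and lip: "L-lipschitz_on UNIV \<phi>" and r: "r > 0"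
  shows "dist x (prox r (\<lambda>y. ereal (\<phi> y)) x) \<le> r * L"
proof -
  define p where "p = prox r (\<lambda>y. ereal (\<phi> y)) x"
  have "inner (x - p) (x - p) / r \<le> \<phi> x - \<phi> p"
    using prox_subgradient[OF assms, of x x] unfolding p_def by simp
  also have "\<dots> \<le> L * dist x p"
    using lipschitz_onD[OF lip, of x p] by (auto simp: dist_real_def)
  finally have "dist x p * dist x p \<le> (r * L) * dist x p"
    using r by (simp add: dist_norm power2_norm_eq_inner[symmetric] power2_eq_square field_simps)
  then have "dist x p \<le> r * L"
    using r lipschitz_on_nonneg[OF lip] by (cases "dist x p = 0") auto
  then show ?thesis unfolding p_def .
qed

text \<open>The discrete evolution variational inequality: the subgradient inequality is inserted
  into the three-point identity for \<open>x\<close>, \<open>p\<close>, \<open>y\<close>, and the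
  nonpositive term \<open>- (dist x p)^2\<close> is dropped.\<close>

lemma prox_evi:
  fixes \<phi> :: "'h::{real_inner, banach} \<Rightarrow> real" and x :: 'h
  assumes cvx: "convex_on UNIV \<phi>" and lip: "L-lipschitz_on UNIV \<phi>" and r: "r > 0"
  defines "p \<equiv> prox r (\<lambda>y. ereal (\<phi> y)) x"
  shows "(dist p y)\<^sup>2 \<le> (dist x y)\<^sup>2 - 2 * r * (\<phi> p - \<phi> y)"
proof -
  have "inner (x - p) (y - p) \<le> - r * (\<phi> p - \<phi> y)"
    using prox_subgradient[OF assms(1-3), of x y] r unfolding p_def[symmetric]
    by (simp add: field_simps)
  moreover have "(dist p y)\<^sup>2 = (dist x y)\<^sup>2 - (dist x p)\<^sup>2 + 2 * inner (x - p) (y - p)"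
    unfolding dist_norm power2_norm_eq_inner
    by (simp add: inner_simps inner_commute algebra_simps)
  ultimately show ?thesis using zero_le_power2[of "dist x p"] by linarith
qed

subsection \<open>Comparison with an explicit Euler scheme\<close>

text \<open>Summing the inequalities of the single steps gives one for the round, once each
  \<open>\<phi> i\<close> is evaluated at \<open>x\<close> instead of the current iterate. The drift
  from \<open>x\<close> is at most \<open>r\<close> times the sum of the Lipschitz constants, so
  this exchange costs only second order in \<open>r\<close>.\<close>

lemma prox_cycle_step:
  fixes \<phi> :: "nat \<Rightarrow> 'h::{real_inner, banach} \<Rightarrow> real" and x z :: 'h
  assumes cvx: "\<And>i. i \<in> {1..n} \<Longrightarrow> convex_on UNIV (\<phi> i)"
    and lip: "\<And>i. i \<in> {1..n} \<Longrightarrow> (L i)-lipschitz_on UNIV (\<phi> i)"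
    and r: "r > 0"
    and sub: "\<And>i. i \<in> {1..n} \<Longrightarrow> \<phi> i z + inner (\<gamma> i) (x - z) - e \<le> \<phi> i x"
  defines "y \<equiv> prox_cycle r n (\<lambda>i y. ereal (\<phi> i y)) x"
  shows dist_prox_cycle_le: "dist x y \<le> r * (\<Sum>i=1..n. L i)"
    and prox_cycle_evi: "(dist y z)\<^sup>2 \<le> (dist x z)\<^sup>2 - 2 * r * inner (\<Sum>i=1..n. \<gamma> i) (x - z)
       + 2 * r * real n * e + 2 * r\<^sup>2 * (\<Sum>i=1..n. L i)\<^sup>2"
proof -
  define T where "T k = prox_cycle r k (\<lambda>i y. ereal (\<phi> i y)) x" for k
  define \<Lambda> where "\<Lambda> k = (\<Sum>i=1..k. L i)" for k
  have T0: "T 0 = x" and TS: "T (Suc k) = prox r (\<lambda>y. ereal (\<phi> (Suc k) y)) (T k)" for k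
    unfolding T_def prox_cycle_def by auto
  \<comment> \<open>Both claims are carried together, since the displacement bound controls the
    Lipschitz loss in the inequality.\<close>
  have "dist x (T k) \<le> r * \<Lambda> k \<and> (dist (T k) z)\<^sup>2 \<le> (dist x z)\<^sup>2
      - 2 * r * inner (\<Sum>i=1..k. \<gamma> i) (x - z) + 2 * r * real k * e + 2 * r\<^sup>2 * (\<Lambda> k)\<^sup>2"
    if "k \<le> n" for k using that
  proof (induction k)
    case 0
    then show ?case by (simp add: T0 \<Lambda>_def)
  next
    case (Suc k)
    let ?i = "Suc k"
    have i: "?i \<in> {1..n}" and kn: "k \<le> n" using Suc.prems by auto
    note IH = Suc.IH[OF kn]
    have L: "0 \<le> L ?i" using lip[OF i] by (rule lipschitz_on_nonneg)
    have L\<Lambda>: "0 \<le> \<Lambda> k"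
      unfolding \<Lambda>_def using kn by (intro sum_nonneg lipschitz_on_nonneg[OF lip]) auto
    have \<Lambda>S: "\<Lambda> ?i = \<Lambda> k + L ?i" by (simp add: \<Lambda>_def)
    have "dist x (T ?i) \<le> dist x (T k) + dist (T k) (T ?i)" by (rule dist_triangle)
    also have "\<dots> \<le> r * \<Lambda> k + r * L ?i"
      using IH dist_prox_le[OF cvx[OF i] lip[OF i] r, of "T k"] unfolding TS by (intro add_mono) auto
    finally have d: "dist x (T ?i) \<le> r * \<Lambda> ?i" by (simp add: \<Lambda>S distrib_left)
    have "\<phi> ?i x - \<phi> ?i (T ?i) \<le> L ?i * dist x (T ?i)"
      using lipschitz_onD[OF lip[OF i], of x "T ?i"] by (auto simp: dist_real_def)
    also have "\<dots> \<le> L ?i * (r * \<Lambda> ?i)" using d L by (rule mult_left_mono)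
    finally have "inner (\<gamma> ?i) (x - z) - e - L ?i * (r * \<Lambda> ?i) \<le> \<phi> ?i (T ?i) - \<phi> ?i z"
      using sub[OF i] by linarith
    then have "2 * r * (inner (\<gamma> ?i) (x - z) - e - L ?i * (r * \<Lambda> ?i))
        \<le> 2 * r * (\<phi> ?i (T ?i) - \<phi> ?i z)"
      using r by (intro mult_left_mono) auto
    moreover have "(dist (T ?i) z)\<^sup>2 \<le> (dist (T k) z)\<^sup>2 - 2 * r * (\<phi> ?i (T ?i) - \<phi> ?i z)"
      unfolding TS by (rule prox_evi[OF cvx[OF i] lip[OF i] r])
    \<comment> \<open>The new error \<open>L ?i * \<Lambda> ?i\<close> is absorbed by the growth of
      the squared sum of the constants.\<close>
    moreover have "2 * r\<^sup>2 * ((\<Lambda> k)\<^sup>2 + L ?i * \<Lambda> ?i) \<le> 2 * r\<^sup>2 * (\<Lambda> ?i)\<^sup>2"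
      unfolding \<Lambda>S using L L\<Lambda> by (intro mult_left_mono) (auto simp: power2_eq_square algebra_simps)
    ultimately have "(dist (T ?i) z)\<^sup>2 \<le> (dist x z)\<^sup>2 - 2 * r * inner (\<Sum>i=1..k. \<gamma> i) (x - z)
        + 2 * r * real k * e - 2 * r * (inner (\<gamma> ?i) (x - z) - e) + 2 * r\<^sup>2 * (\<Lambda> ?i)\<^sup>2"
      using IH by (simp add: power2_eq_square algebra_simps)
    also have "\<dots> = (dist x z)\<^sup>2 - 2 * r * inner (\<Sum>i=1..?i. \<gamma> i) (x - z)
        + 2 * r * real ?i * e + 2 * r\<^sup>2 * (\<Lambda> ?i)\<^sup>2"
      by (simp add: inner_add_left algebra_simps)
    finally show ?case using d by blast
  qed
  from this[of n] show "dist x y \<le> r * (\<Sum>i=1..n. L i)"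
    and "(dist y z)\<^sup>2 \<le> (dist x z)\<^sup>2 - 2 * r * inner (\<Sum>i=1..n. \<gamma> i) (x - z)
       + 2 * r * real n * e + 2 * r\<^sup>2 * (\<Sum>i=1..n. L i)\<^sup>2"
    by (simp_all add: y_def T_def \<Lambda>_def)
qed

text \<open>
  Collects the error terms of \<open>euler_comparison\<close>; only its independence of \<open>m\<close> and \<open>N\<close> matters.
\<close>

definition euler_const :: "real \<Rightarrow> real \<Rightarrow> real" where
  "euler_const t C = 2 * (1 + t * (5 * t * C\<^sup>2 + 4 * C * (1 + 3 * t * C) + 2 * (5 + 10 * t * C)))
     + 2 * (1 + 3 * t * C)\<^sup>2"

text \<open>The direction at \<open>z j\<close> enters both the variational inequality of
  \<open>x\<close> and the motion of \<open>z\<close>, so the terms linear in their difference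
  cancel. The squared distance grows only by order \<open>1 / m\<close> times the fine step
  \<open>t / N\<close> in each step, and no exponential factor arises. Requiring
  \<open>N \<ge> m^2\<close> keeps the total loss at the \<open>m\<close> changes of direction of
  order \<open>1 / m\<close>.\<close>

lemma euler_comparison:
  fixes x z G :: "nat \<Rightarrow> 'h::real_inner"
  assumes t: "t > 0" and C: "C \<ge> 0" and m: "m \<ge> 1" and N: "N \<ge> m\<^sup>2"
    and start: "dist (x 0) (z 0) \<le> 1 / (real m)\<^sup>2"
    and euler: "\<And>j. dist (z (Suc j)) (z j - (t / real m) *\<^sub>R G j) \<le> 1 / (real m)\<^sup>2"
    and G: "\<And>j. norm (G j) \<le> C"
    and move: "\<And>k. k < N \<Longrightarrow> dist (x k) (x (Suc k)) \<le> t / real N * C"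
    and evi: "\<And>k j. k < N \<Longrightarrow> j < m \<Longrightarrow> (dist (x (Suc k)) (z j))\<^sup>2 \<le> (dist (x k) (z j))\<^sup>2
       - 2 * (t / real N) * inner (G j) (x k - z j)
       + 2 * (t / real N) / real m * (1 + 2 * dist (x k) (z j)) + 2 * (t / real N)\<^sup>2 * C\<^sup>2"
  shows "(dist (x N) (z m))\<^sup>2 \<le> euler_const t C / real m"
proof -
  define h where "h = t / real N"
  define j where "j k = k * m div N" for k
  define \<tau> where "\<tau> k = real k * h - real (j k) * (t / real m)" for k
  \<comment> \<open>\<open>\<zeta>\<close> moves in the fine steps \<open>h\<close> of \<open>x\<close> but along the coarse directions \<open>G\<close>, so it can be compared
    with both \<open>x\<close> and \<open>z\<close>, although \<open>m\<close> need not divide \<open>N\<close>; \<open>j k\<close> is the coarse interval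
    containing \<open>k h\<close> and \<open>\<tau> k\<close> the time spent in it.\<close>
  define \<zeta> where "\<zeta> k = z 0 - h *\<^sub>R (\<Sum>i<k. G (j i))" for k
  define \<rho> where "\<rho> = (1 + 3 * t * C) / real m"
  define R where "R = 5 * t * C + 2"
  have mm: "m \<le> m\<^sup>2" by (simp add: power2_eq_square)
  then have mN: "m \<le> N" and N0: "N > 0" using N m by linarith+
  have h0: "h > 0" unfolding h_def using t N0 by simp
  have hN: "real N * h = t" unfolding h_def using N0 by simp
  have mh: "real m * h \<le> t / real m"
  proof -
    have "real m * real m \<le> real N" using N by (simp add: power2_eq_square flip: of_nat_mult)
    then have "real m * real m * h \<le> real N * h" using h0 by (intro mult_right_mono) auto
    then show ?thesis using m hN by (simp add: field_simps)
  qed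
  have h_le: "h \<le> t / real m"
    using mh m h0 mult_right_mono[of 1 "real m" h] by linarith
  have j_lt: "j k < m" if "k < N" for k
    using that m unfolding j_def by (simp add: less_mult_imp_div_less)
  have j_le: "j k \<le> m" if "k \<le> N" for k
    using that N0 unfolding j_def by (metis div_le_mono div_mult_self1_is_m mult.commute mult_le_mono1)
  have jN: "j N = m" unfolding j_def using N0 by simp
  have lower: "j k * N \<le> k * m" for k unfolding j_def by simp
  have upper: "k * m < Suc (j k) * N" for k
    unfolding j_def using N0 by (simp add: dividend_less_div_times)
  have tN: "t = h * real N" unfolding h_def using N0 by simp
  have \<tau>_eq: "\<tau> k = h / real m * (real (k * m) - real (j k * N))" for k
    unfolding \<tau>_def tN using m by (simp add: field_simps)
  have \<tau>0: "0 \<le> \<tau> k" for k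
    unfolding \<tau>_eq using lower[of k] h0 by (intro mult_nonneg_nonneg) (auto simp flip: of_nat_mult)
  have \<tau>1: "\<tau> k \<le> t / real m" for k
  proof -
    have "real (k * m) - real (j k * N) \<le> real N"
      using upper[of k] by (simp del: of_nat_mult)
    then have "\<tau> k \<le> h / real m * real N"
      unfolding \<tau>_eq using h0 by (intro mult_left_mono) auto
    then show ?thesis by (simp add: tN)
  qed
  \<comment> \<open>Within a coarse interval the deviation does not change; each passage to the next
    one adds the Euler defect \<open>1 / m^2\<close> and the effect of one fine step taken partly in
    the old direction.\<close>
  have near: "norm (\<zeta> k - (z (j k) - \<tau> k *\<^sub>R G (j k))) \<le> real (j k) * (1 / (real m)\<^sup>2 + 2 * h * C)" for k
  proof (induction k)
    case 0
    show ?case by (simp add: \<zeta>_def j_def \<tau>_def)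
  next
    case (Suc k)
    have \<zeta>S: "\<zeta> (Suc k) = \<zeta> k - h *\<^sub>R G (j k)" by (simp add: \<zeta>_def algebra_simps)
    have "j k \<le> j (Suc k)" unfolding j_def by (simp add: div_le_mono)
    \<comment> \<open>Since \<open>m \<le> N\<close>, a fine step is no longer than a coarse one and
      cannot skip an interval.\<close>
    moreover have "j (Suc k) < Suc (Suc (j k))"
    proof -
      have "Suc k * m < Suc (Suc (j k)) * N" using upper[of k] mN by simp
      then show ?thesis unfolding j_def[of "Suc k"] by (rule less_mult_imp_div_less)
    qed
    ultimately consider "j (Suc k) = j k" | "j (Suc k) = Suc (j k)" by linarith
    then show ?case
    proof cases
      case 1
      then have "\<tau> (Suc k) = \<tau> k + h" by (simp add: \<tau>_def algebra_simps)
      then have eq: "\<zeta> (Suc k) - (z (j (Suc k)) - \<tau> (Suc k) *\<^sub>R G (j (Suc k)))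
          = \<zeta> k - (z (j k) - \<tau> k *\<^sub>R G (j k))"
        unfolding 1 \<zeta>S by (simp add: algebra_simps)
      show ?thesis using Suc unfolding eq unfolding 1 .
    next
      case 2
      let ?a = "\<zeta> k - (z (j k) - \<tau> k *\<^sub>R G (j k))"
      let ?b = "z (Suc (j k)) - (z (j k) - (t / real m) *\<^sub>R G (j k))"
      let ?c = "\<tau> (Suc k) *\<^sub>R (G (Suc (j k)) - G (j k))"
      have \<tau>S: "\<tau> (Suc k) + t / real m = \<tau> k + h" using 2 by (simp add: \<tau>_def algebra_simps)
      \<comment> \<open>\<open>\<tau> (Suc k)\<close> is the part of the fine step beyond the
        interval boundary, where \<open>\<zeta>\<close> still follows
        \<open>G (j k)\<close>.\<close>
      have "\<tau> (Suc k) \<le> h" using \<tau>S \<tau>1[of k] by linarith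
      have G2: "norm (G (Suc (j k)) - G (j k)) \<le> 2 * C"
        using norm_triangle_ineq4[of "G (Suc (j k))" "G (j k)"] G[of "Suc (j k)"] G[of "j k"] by linarith
      have c: "norm ?c \<le> 2 * h * C"
        using mult_mono[OF \<open>\<tau> (Suc k) \<le> h\<close> G2] \<tau>0[of "Suc k"] h0 by simp
      have "(\<tau> (Suc k) + t / real m) *\<^sub>R G (j k) = (\<tau> k + h) *\<^sub>R G (j k)" by (simp only: \<tau>S)
      then have eq: "\<zeta> (Suc k) - (z (j (Suc k)) - \<tau> (Suc k) *\<^sub>R G (j (Suc k))) = ?a - ?b + ?c"
        unfolding 2 \<zeta>S by (simp add: algebra_simps)
      also have "norm \<dots> \<le> norm ?a + norm ?b + norm ?c"
        by (meson add_mono_thms_linordered_semiring(3) norm_triangle_ineq norm_triangle_ineq4 order_trans)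
      also have "\<dots> \<le> real (j k) * (1 / (real m)\<^sup>2 + 2 * h * C) + 1 / (real m)\<^sup>2 + 2 * h * C"
        using Suc euler[of "j k"] c unfolding dist_norm by (intro add_mono) auto
      also have "\<dots> = real (j (Suc k)) * (1 / (real m)\<^sup>2 + 2 * h * C)"
        unfolding 2 by (simp add: distrib_right)
      finally show ?thesis .
    qed
  qed
  \<comment> \<open>\<open>\<rho>\<close> collects \<open>1 / m\<close> from the Euler defects,
    \<open>2 * t * C / m\<close> from the direction changes and \<open>t * C / m\<close> from the
    travel inside the current interval.\<close>
  have \<zeta>z: "dist (\<zeta> k) (z (j k)) \<le> \<rho>" if "k \<le> N" for k
  proof -
    have "\<zeta> k - z (j k) = (\<zeta> k - (z (j k) - \<tau> k *\<^sub>R G (j k))) - \<tau> k *\<^sub>R G (j k)" by simp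
    also have "norm \<dots> \<le> norm (\<zeta> k - (z (j k) - \<tau> k *\<^sub>R G (j k))) + norm (\<tau> k *\<^sub>R G (j k))"
      by (rule norm_triangle_ineq4)
    also have "norm (\<zeta> k - (z (j k) - \<tau> k *\<^sub>R G (j k))) \<le> real m * (1 / (real m)\<^sup>2 + 2 * h * C)"
      using near[of k] j_le[OF that] C h0
      by (meson add_nonneg_nonneg divide_nonneg_nonneg less_imp_le mult_nonneg_nonneg mult_right_mono
          of_nat_le_iff order_trans zero_le_numeral zero_le_one zero_le_power2)
    also have "\<dots> = 1 / real m + 2 * (real m * h) * C"
      using m by (simp add: field_simps power2_eq_square)
    also have "\<dots> \<le> 1 / real m + 2 * (t / real m) * C"
      using mh C by (intro add_mono mult_right_mono mult_left_mono) auto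
    also have "norm (\<tau> k *\<^sub>R G (j k)) \<le> t / real m * C"
      using mult_mono[OF \<tau>1[of k] G[of "j k"]] \<tau>0[of k] t by simp
    finally show ?thesis by (simp add: \<rho>_def dist_norm add_divide_distrib algebra_simps)
  qed
  have \<rho>0: "0 \<le> \<rho>" unfolding \<rho>_def using t C by simp
  have xx: "dist (x 0) (x k) \<le> real k * (h * C)" if "k \<le> N" for k using that
  proof (induction k)
    case (Suc k)
    have "dist (x 0) (x (Suc k)) \<le> dist (x 0) (x k) + dist (x k) (x (Suc k))" by (rule dist_triangle)
    also have "\<dots> \<le> real k * (h * C) + h * C"
      using Suc move[of k] unfolding h_def by (intro add_mono) auto
    finally show ?case by (simp add: distrib_right)
  qed simp
  have \<zeta>\<zeta>: "dist (\<zeta> 0) (\<zeta> k) \<le> real k * (h * C)" for k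
  proof -
    have "norm (\<Sum>i<k. G (j i)) \<le> real k * C"
      using sum_norm_bound[of "{..<k}" "\<lambda>i. G (j i)" C] G by simp
    then have "h * norm (\<Sum>i<k. G (j i)) \<le> h * (real k * C)" using h0 by simp
    then show ?thesis using h0 by (simp add: dist_norm \<zeta>_def algebra_simps)
  qed
  have m1: "1 / real m \<le> 1" "1 / (real m)\<^sup>2 \<le> 1 / real m"
    using m by (auto simp: power2_eq_square field_simps)
  \<comment> \<open>A crude a priori bound: \<open>x\<close> and \<open>\<zeta>\<close> each travel
    at most \<open>t * C\<close>, the initial gap is at most 1 and \<open>\<rho>\<close> is at most
    \<open>1 + 3 * t * C\<close>.\<close>
  have xz: "dist (x k) (z (j k)) \<le> R" if k: "k \<le> N" for k
  proof -
    have "real k * (h * C) \<le> t * C"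
      using k h0 C hN mult_right_mono[of "real k" "real N" "h * C"] by (simp flip: mult.assoc)
    moreover have "\<rho> \<le> 1 + 3 * t * C"
      unfolding \<rho>_def using divide_left_mono[of 1 "real m" "1 + 3 * t * C"] m t C by simp
    moreover have "dist (x k) (z (j k)) \<le> dist (x 0) (x k) + dist (x 0) (z 0) + dist (\<zeta> 0) (\<zeta> k) + dist (\<zeta> k) (z (j k))"
      using dist_triangle[of "x k" "z (j k)" "\<zeta> k"] dist_triangle[of "x k" "\<zeta> k" "x 0"]
        dist_triangle[of "x 0" "\<zeta> k" "\<zeta> 0"] by (simp add: \<zeta>_def dist_commute)
    ultimately show ?thesis
      using xx[OF k] \<zeta>\<zeta>[of k] \<zeta>z[OF k] start m1 unfolding R_def by linarith
  qed
  define E where "E = 5 * t * C\<^sup>2 + 4 * C * (1 + 3 * t * C) + 2 * (1 + 2 * R)"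
  have E: "4 * \<rho> * C + 5 * h * C\<^sup>2 + 2 / real m * (1 + 2 * R) \<le> E / real m"
  proof -
    have "h * (5 * C\<^sup>2) \<le> t / real m * (5 * C\<^sup>2)" using h_le by (intro mult_right_mono) auto
    then show ?thesis unfolding E_def \<rho>_def by (simp add: add_divide_distrib algebra_simps)
  qed
  have main: "(dist (x k) (\<zeta> k))\<^sup>2 \<le> 1 / real m + real k * h * (E / real m)" if "k \<le> N" for k
    using that
  proof (induction k)
    case 0
    have "(dist (x 0) (\<zeta> 0))\<^sup>2 \<le> (1 / (real m)\<^sup>2)\<^sup>2"
      using start by (intro power_mono) (auto simp: \<zeta>_def)
    also have "\<dots> \<le> 1 / (real m)\<^sup>2"
      using power_decreasing[of 1 2 "1 / (real m)\<^sup>2"] m1 by simp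
    finally show ?case using m1 by simp
  next
    case (Suc k)
    then have k: "k < N" by simp
    define d where "d = x (Suc k) - x k"
    define a where "a = x k - \<zeta> k"
    define w where "w = \<zeta> k - z (j k)"
    define g where "g = G (j k)"
    have d: "norm d \<le> h * C" using move[OF k] by (simp add: d_def dist_norm norm_minus_commute h_def)
    have w: "norm w \<le> \<rho>" using \<zeta>z[of k] k by (simp add: w_def dist_norm)
    have g: "norm g \<le> C" unfolding g_def by (rule G)
    have "x (Suc k) - \<zeta> (Suc k) = a + d + h *\<^sub>R g"
      by (simp add: a_def d_def g_def \<zeta>_def algebra_simps)
    then have lhs: "(dist (x (Suc k)) (\<zeta> (Suc k)))\<^sup>2
        = inner (a + d) (a + d) + 2 * h * inner g (a + d) + h\<^sup>2 * (norm g)\<^sup>2"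
      unfolding dist_norm power2_norm_eq_inner
      by (simp add: inner_simps inner_commute power2_eq_square algebra_simps)
    have "(dist (x (Suc k)) (z (j k)))\<^sup>2 = inner (a + d) (a + d) + 2 * inner w a + 2 * inner w d + inner w w"
      unfolding dist_norm power2_norm_eq_inner a_def d_def w_def
      by (simp add: inner_simps inner_commute algebra_simps)
    moreover have "(dist (x k) (z (j k)))\<^sup>2 = inner a a + 2 * inner w a + inner w w"
      unfolding dist_norm power2_norm_eq_inner a_def w_def
      by (simp add: inner_simps inner_commute algebra_simps)
    moreover have "inner (G (j k)) (x k - z (j k)) = inner g a + inner g w"
      by (simp add: g_def a_def w_def inner_simps)
    \<comment> \<open>Here \<open>- 2 * h * inner g a\<close> cancels its opposite in
      \<open>lhs\<close>, which comes from the motion of \<open>\<zeta>\<close>; all that remains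
      beyond \<open>inner a a\<close> is of order \<open>h / m\<close> or
      \<open>h^2\<close>.\<close>
    ultimately have step: "inner (a + d) (a + d) \<le> inner a a - 2 * inner w d - 2 * h * (inner g a + inner g w)
        + 2 * h / real m * (1 + 2 * dist (x k) (z (j k))) + 2 * h\<^sup>2 * C\<^sup>2"
      using evi[OF k j_lt[OF k]] unfolding h_def[symmetric] by simp
    have "- inner w d \<le> \<rho> * (h * C)"
      using Cauchy_Schwarz_ineq2[of w d] mult_mono[OF w d] \<rho>0 by simp
    moreover have "h * inner g d \<le> h * (C * (h * C))"
      using Cauchy_Schwarz_ineq2[of g d] mult_mono[OF g d] C h0 by (intro mult_left_mono) auto
    moreover have "h * (- inner g w) \<le> h * (C * \<rho>)"
      using Cauchy_Schwarz_ineq2[of g w] mult_mono[OF g w] C h0 by (intro mult_left_mono) auto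
    moreover have "h\<^sup>2 * (norm g)\<^sup>2 \<le> h\<^sup>2 * C\<^sup>2"
      using g by (intro mult_left_mono power_mono) auto
    moreover have "2 * h / real m * (1 + 2 * dist (x k) (z (j k))) \<le> 2 * h / real m * (1 + 2 * R)"
      using xz[of k] k h0 by (intro mult_left_mono) auto
    ultimately have "(dist (x (Suc k)) (\<zeta> (Suc k)))\<^sup>2
        \<le> inner a a + h * (4 * \<rho> * C + 5 * h * C\<^sup>2 + 2 / real m * (1 + 2 * R))"
      using step unfolding lhs
      by (simp add: inner_add_right add_divide_distrib power2_eq_square algebra_simps)
    also have "\<dots> \<le> inner a a + h * (E / real m)"
      using E h0 by (intro add_left_mono mult_left_mono) auto
    also have "inner a a = (dist (x k) (\<zeta> k))\<^sup>2" by (simp add: a_def dist_norm power2_norm_eq_inner)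
    finally show ?case using Suc by (simp add: algebra_simps)
  qed
  have "dist (x N) (z m) \<le> dist (x N) (\<zeta> N) + dist (\<zeta> N) (z m)" by (rule dist_triangle)
  then have "(dist (x N) (z m))\<^sup>2 \<le> (dist (x N) (\<zeta> N) + dist (\<zeta> N) (z m))\<^sup>2"
    by (intro power_mono) auto
  also have "\<dots> \<le> 2 * (dist (x N) (\<zeta> N))\<^sup>2 + 2 * (dist (\<zeta> N) (z m))\<^sup>2"
    using zero_le_power2[of "dist (x N) (\<zeta> N) - dist (\<zeta> N) (z m)"] by (simp add: power2_eq_square algebra_simps)
  also have "(dist (x N) (\<zeta> N))\<^sup>2 \<le> 1 / real m + t * (E / real m)"
    using main[of N] hN by simp
  also have "(dist (\<zeta> N) (z m))\<^sup>2 \<le> \<rho>\<^sup>2"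
    using \<zeta>z[of N] jN by (intro power_mono) auto
  also have "\<rho>\<^sup>2 \<le> (1 + 3 * t * C)\<^sup>2 / real m"
    unfolding \<rho>_def power_divide using m m1(2) by (intro divide_left_mono) (auto simp: power2_eq_square)
  finally show ?thesis
    unfolding euler_const_def E_def R_def by (simp add: add_divide_distrib distrib_left algebra_simps)
qed

subsection \<open>The strong law of large numbers\<close>

text \<open>Boundedness makes all products and squares integrable; a summand is independent of the
  remaining partial sum, so their covariance vanishes in the induction.\<close>

lemma (in prob_space) indep_vars_variance_sum_bounded:
  fixes W :: "'i \<Rightarrow> 'a \<Rightarrow> real"
  assumes "finite I" "indep_vars (\<lambda>_. borel) W I"
    and bound: "\<And>i \<omega>. i \<in> I \<Longrightarrow> \<omega> \<in> space M \<Longrightarrow> \<bar>W i \<omega>\<bar> \<le> b"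
  shows "variance (\<lambda>\<omega>. \<Sum>i\<in>I. W i \<omega>) = (\<Sum>i\<in>I. variance (W i))"
  using assms
proof (induction I)
  case empty
  then show ?case by simp
next
  case (insert i I)
  have meas [measurable]: "W j \<in> borel_measurable M" if "j \<in> insert i I" for j
    using insert.prems(1) that unfolding indep_vars_def by blast
  define V where "V \<omega> = (\<Sum>j\<in>I. W j \<omega>)" for \<omega>
  have [measurable]: "V \<in> borel_measurable M" unfolding V_def by measurable
  have Wb: "\<bar>W i \<omega>\<bar> \<le> b" if "\<omega> \<in> space M" for \<omega> using insert.prems(2) that by blast
  have Vb: "\<bar>V \<omega>\<bar> \<le> real (card I) * b" if "\<omega> \<in> space M" for \<omega>
    unfolding V_def using insert.prems(2) that by (intro order_trans[OF sum_abs] sum_bounded_above) auto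
  have int: "integrable M f" "integrable M (\<lambda>\<omega>. (f \<omega>)\<^sup>2)"
    if [measurable]: "f \<in> borel_measurable M" and f: "\<And>\<omega>. \<omega> \<in> space M \<Longrightarrow> \<bar>f \<omega>\<bar> \<le> B" for f :: "'a \<Rightarrow> real" and B
  proof -
    show "integrable M f" using f by (intro integrable_const_bound[where B=B] AE_I2) auto
    have "norm ((f \<omega>)\<^sup>2) \<le> B\<^sup>2" if "\<omega> \<in> space M" for \<omega>
      using power_mono[OF f[OF that], of 2] by simp
    then show "integrable M (\<lambda>\<omega>. (f \<omega>)\<^sup>2)" by (intro integrable_const_bound[where B="B\<^sup>2"] AE_I2) auto
  qed
  note [simp] = int[of "W i", OF _ Wb] int[of V, OF _ Vb]
  have indep: "indep_var borel (W i) borel V"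
    unfolding V_def by (rule indep_vars_sum[OF insert(1,2) insert.prems(1)])
  have prod [simp]: "integrable M (\<lambda>\<omega>. W i \<omega> * V \<omega>)"
      "expectation (\<lambda>\<omega>. W i \<omega> * V \<omega>) = expectation (W i) * expectation V"
    using indep_var_integrable[OF indep] indep_var_lebesgue_integral[OF indep] by auto
  have sq: "(\<lambda>\<omega>. (W i \<omega> + V \<omega>)\<^sup>2) = (\<lambda>\<omega>. (W i \<omega>)\<^sup>2 + 2 * (W i \<omega> * V \<omega>) + (V \<omega>)\<^sup>2)"
    by (simp add: power2_eq_square algebra_simps)
  have "variance (\<lambda>\<omega>. \<Sum>j\<in>insert i I. W j \<omega>) = variance (\<lambda>\<omega>. W i \<omega> + V \<omega>)"
    using insert(1,2) by (simp add: V_def)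
  also have "\<dots> = variance (W i) + variance V"
  proof -
    have "variance (\<lambda>\<omega>. W i \<omega> + V \<omega>)
        = expectation (\<lambda>\<omega>. (W i \<omega> + V \<omega>)\<^sup>2) - (expectation (W i) + expectation V)\<^sup>2"
      by (subst variance_eq) (auto simp: sq)
    also have "\<dots> = expectation (\<lambda>\<omega>. (W i \<omega>)\<^sup>2) + 2 * (expectation (W i) * expectation V)
        + expectation (\<lambda>\<omega>. (V \<omega>)\<^sup>2) - (expectation (W i) + expectation V)\<^sup>2"
      unfolding sq by simp
    also have "\<dots> = variance (W i) + variance V"
      by (simp add: variance_eq power2_sum)
    finally show ?thesis .
  qed
  also have "variance V = (\<Sum>j\<in>I. variance (W j))"
    unfolding V_def using insert.prems by (intro insert.IH indep_vars_subset[OF insert.prems(1)]) auto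
  finally show ?case using insert(1,2) by simp
qed

text \<open>Through this bound, second moments truncated at dyadic levels become summable when only
  the first moment is finite.\<close>

lemma dyadic_truncation_sum_le:
  fixes a :: real
  assumes "a \<ge> 0"
  shows "(\<Sum>k<n. (min a (2 ^ k))\<^sup>2 / 2 ^ k) \<le> 6 * a"
proof (cases "a = 0")
  case False
  with assms have a: "a > 0" by simp
  \<comment> \<open>a summand at \<open>u = 2^k\<close> is at most the increment of the bounded function \<open>H\<close> from \<open>u\<close> to \<open>2 u\<close>\<close>
  define H where "H u = 6 * a * u / (a + u)" for u
  have step: "(min a u)\<^sup>2 / u \<le> H (2 * u) - H u" if u: "u > 0" for u
  proof -
    \<comment> \<open>In either case \<open>(a + 2 * u) * (a + u)\<close> is at most 6 times the
      square of the larger of \<open>a\<close> and \<open>u\<close>, while \<open>min a u\<close>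
      times the larger equals \<open>a * u\<close>.\<close>
    have "(min a u)\<^sup>2 * ((a + 2 * u) * (a + u)) \<le> 6 * (a\<^sup>2 * u\<^sup>2)"
    proof (cases "a \<le> u")
      case True
      then have "(a + 2 * u) * (a + u) \<le> (3 * u) * (2 * u)" using a u by (intro mult_mono) auto
      from mult_left_mono[OF this, of "a\<^sup>2"] show ?thesis
        using True by (simp add: power2_eq_square algebra_simps)
    next
      case False
      then have "(a + 2 * u) * (a + u) \<le> (3 * a) * (2 * a)" using a u by (intro mult_mono) auto
      from mult_left_mono[OF this, of "u\<^sup>2"] show ?thesis
        using False by (simp add: power2_eq_square algebra_simps)
    qed
    then have "(min a u)\<^sup>2 \<le> 6 * (a\<^sup>2 * u\<^sup>2) / ((a + 2 * u) * (a + u))"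
      using a u by (simp add: pos_le_divide_eq)
    then have "(min a u)\<^sup>2 / u \<le> 6 * (a\<^sup>2 * u\<^sup>2) / ((a + 2 * u) * (a + u)) / u"
      using u by (intro divide_right_mono) auto
    also have "\<dots> = H (2 * u) - H u"
      unfolding H_def using a u by (simp add: divide_simps) (simp add: power2_eq_square algebra_simps)
    finally show ?thesis .
  qed
  have "(\<Sum>k<n. (min a (2 ^ k))\<^sup>2 / 2 ^ k) \<le> (\<Sum>k<n. H (2 ^ Suc k) - H (2 ^ k))"
    using step by (intro sum_mono) auto
  also have "\<dots> = H (2 ^ n) - H 1" by (subst sum_lessThan_telescope) simp
  also have "\<dots> \<le> H (2 ^ n)" unfolding H_def using a by simp
  also have "\<dots> \<le> 6 * a"
    unfolding H_def using a by (simp add: divide_le_eq add_pos_pos algebra_simps)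
  finally show ?thesis .
qed (simp add: min_def)

locale iid_sequence = prob_space +
  fixes N :: "'e measure" and X :: "nat \<Rightarrow> 'a \<Rightarrow> 'e"
  assumes indep: "indep_vars (\<lambda>_. N) X {1..}"
    and law: "\<And>i. i \<ge> 1 \<Longrightarrow> distr M N (X i) = N"
begin

lemma rv [measurable]: "i \<ge> 1 \<Longrightarrow> X i \<in> measurable M N"
  using indep unfolding indep_vars_def by auto

lemma prob_space_N: "prob_space N"
  using prob_space_distr[OF rv[of 1]] law[of 1] by simp

lemma integral_comp: 
  fixes g :: "'e \<Rightarrow> 'b::{banach, second_countable_topology}"
  assumes "i \<ge> 1" "g \<in> borel_measurable N"
  shows "(\<integral>\<omega>. g (X i \<omega>) \<partial>M) = integral\<^sup>L N g"
  using integral_distr[OF rv[OF assms(1)] assms(2)] law[OF assms(1)] by simp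

lemma prob_comp:
  assumes "i \<ge> 1" "A \<in> sets N"
  shows "prob (X i -` A \<inter> space M) = measure N A"
  using measure_distr[OF rv[OF assms(1)] assms(2)] law[OF assms(1)] by simp

lemma indep_comp:
  assumes "\<phi> \<in> borel_measurable N" "I \<subseteq> {1..}"
  shows "indep_vars (\<lambda>_. borel) (\<lambda>i \<omega>. \<phi> (X i \<omega>)) I"
  using assms by (intro indep_vars_compose2[OF indep_vars_subset[OF indep]]) auto

text \<open>Hoeffding's inequality makes deviations by \<open>c\<close> exponentially unlikely, so
  Borel-Cantelli excludes them for all large \<open>n\<close>; countably many values of
  \<open>c\<close> give convergence.\<close>

lemma strong_law_indicator:
  assumes A [measurable]: "A \<in> sets N"
  shows "AE \<omega> in M. (\<lambda>n. (\<Sum>i=1..n. indicator A (X i \<omega>)) / real n) \<longlonglongrightarrow> measure N A"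
proof -
  interpret N: prob_space N by (rule prob_space_N)
  let ?avg = "\<lambda>n \<omega>. (\<Sum>i=1..n. indicator A (X i \<omega>)) / real n :: real"
  have AE_c: "AE \<omega> in M. eventually (\<lambda>n. \<bar>?avg n \<omega> - measure N A\<bar> < c) sequentially"
    if c: "c > 0" for c
  proof -
    \<comment> \<open>Indexing by \<open>Suc n\<close> keeps the sample nonempty;
      \<open>eventually_sequentially_Suc\<close> undoes the shift.\<close>
    define B where "B n = {\<omega>\<in>space M. \<bar>?avg (Suc n) \<omega> - measure N A\<bar> \<ge> c}" for n
    have [measurable]: "X i \<in> measurable M N" if "i \<in> {1..n}" for i n using that by simp
    have B [measurable]: "B n \<in> sets M" for n unfolding B_def by measurable
    have bound: "prob (B n) \<le> 2 * exp (-2 * c\<^sup>2) ^ Suc n" for n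
    proof -
      have distr_eq: "distr M borel (\<lambda>\<omega>. indicator A (X i \<omega>)) = distr N borel (indicator A :: 'e \<Rightarrow> real)"
        if "i \<ge> 1" for i
        using distr_distr[of "indicator A :: 'e \<Rightarrow> real" N borel "X i" M] law[OF that] that
        by (simp add: comp_def)
      interpret H: Hoeffding_ineq_iid M "{1..Suc n}" "\<lambda>i \<omega>. indicator A (X i \<omega>)"
        "\<lambda>\<omega>. indicator A (X 1 \<omega>)" 0 1 "measure N A"
      proof unfold_locales
        show "indep_vars (\<lambda>_. borel) (\<lambda>i \<omega>. indicator A (X i \<omega>) :: real) {1..Suc n}"
          by (rule indep_comp) auto
        show "distr M borel (\<lambda>\<omega>. indicator A (X i \<omega>)) = distr M borel (\<lambda>\<omega>. indicator A (X 1 \<omega>) :: real)"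
          if "i \<in> {1..Suc n}" for i
          using that distr_eq[of i] distr_eq[of 1] by simp
        show "random_variable borel (\<lambda>\<omega>. indicator A (X 1 \<omega>) :: real)"
          by simp
        show "AE \<omega> in M. (indicator A (X 1 \<omega>) :: real) \<in> {0..1}"
          by (rule AE_I2) (simp split: split_indicator)
        have "expectation (\<lambda>\<omega>. indicator A (X 1 \<omega>) :: real) = (\<integral>e. indicator A e \<partial>N)"
          by (rule integral_comp) auto
        then show "measure N A \<equiv> expectation (\<lambda>\<omega>. indicator A (X 1 \<omega>))"
          by simp
      qed simp
      have "exp (-2 * c\<^sup>2) ^ Suc n = exp (-2 * real (Suc n) * c\<^sup>2 / (1 - 0)\<^sup>2)"
        unfolding exp_of_nat_mult[symmetric] by (simp add: algebra_simps)
      then show ?thesis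
        using H.Hoeffding_ineq_abs_ge'[of c] c unfolding B_def by simp
    qed
    have "summable (\<lambda>n. 2 * exp (-2 * c\<^sup>2) ^ Suc n)"
      using c by (intro summable_mult summable_Suc_iff[THEN iffD2] summable_geometric) auto
    then have "summable (\<lambda>n. prob (B n))"
      by (rule summable_comparison_test') (use bound in auto)
    then have "AE \<omega> in M. eventually (\<lambda>n. \<omega> \<in> space M - B n) sequentially"
      by (intro borel_cantelli_AE1) (auto simp: emeasure_eq_measure)
    then show ?thesis
    proof eventually_elim
      case (elim \<omega>)
      then have "eventually (\<lambda>n. \<bar>?avg (Suc n) \<omega> - measure N A\<bar> < c) sequentially"
        by eventually_elim (auto simp: B_def)
      then show ?case by (subst (asm) eventually_sequentially_Suc)
    qed
  qed
  have "AE \<omega> in M. \<forall>j. eventually (\<lambda>n. \<bar>?avg n \<omega> - measure N A\<bar> < 1 / real (Suc j)) sequentially"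
    unfolding AE_all_countable using AE_c by simp
  then show ?thesis
  proof eventually_elim
    case (elim \<omega>)
    show ?case
    proof (rule tendstoI)
      fix e :: real assume "e > 0"
      then obtain j where "1 / real (Suc j) < e" using nat_approx_posE by blast
      with elim[rule_format, of j] show "eventually (\<lambda>n. dist (?avg n \<omega>) (measure N A) < e) sequentially"
        by (auto simp: dist_real_def elim: eventually_mono)
    qed
  qed
qed

text \<open>Truncate at \<open>n = 2 ^ k\<close>. Either some value exceeds \<open>n\<close>, which
  is unlikely by the union bound and a Markov estimate, or the truncated sum deviates from its mean,
  which Chebyshev controls. Both are measured by the truncated second moment over \<open>n\<close>,
  whence the factor \<open>1 + 1 / c^2\<close>.\<close>

lemma prob_dyadic_sum_le:
  fixes \<phi> :: "'e \<Rightarrow> real"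
  assumes int: "integrable N \<phi>" and nonneg: "\<And>e. e \<in> space N \<Longrightarrow> 0 \<le> \<phi> e" and c: "c > 0"
  shows "prob {\<omega>\<in>space M. (\<Sum>i=1..2^k. \<phi> (X i \<omega>)) \<ge> 2 ^ k * (integral\<^sup>L N \<phi> + c)}
    \<le> (1 + 1 / c\<^sup>2) * (\<integral>e. (min (\<phi> e) (2 ^ k))\<^sup>2 / 2 ^ k \<partial>N)"
proof -
  interpret N: prob_space N by (rule prob_space_N)
  define n :: nat where "n = 2 ^ k"
  have n: "real n = 2 ^ k" "n \<ge> 1" "real n > 0" by (auto simp: n_def)
  define \<psi> where "\<psi> e = min (\<phi> e) (real n)" for e
  have \<phi> [measurable]: "\<phi> \<in> borel_measurable N" using int by simp
  have \<psi> [measurable]: "\<psi> \<in> borel_measurable N" unfolding \<psi>_def by measurable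
  have [measurable]: "X i \<in> measurable M N" if "i \<in> {1..n}" for i using that by simp
  have \<psi>_bound: "0 \<le> \<psi> e" "\<psi> e \<le> real n" if "e \<in> space N" for e
    using nonneg[OF that] by (auto simp: \<psi>_def)
  have \<psi>_int [simp]: "integrable N \<psi>"
    using \<psi>_bound by (intro N.integrable_const_bound[where B="real n"] AE_I2) auto
  have \<psi>2_int [simp]: "integrable N (\<lambda>e. (\<psi> e)\<^sup>2)"
    using \<psi>_bound by (intro N.integrable_const_bound[where B="(real n)\<^sup>2"] AE_I2) (auto simp: power_mono)
  define b where "b = (\<integral>e. (\<psi> e)\<^sup>2 \<partial>N)"
  have X_space: "X i \<omega> \<in> space N" if "i \<ge> 1" "\<omega> \<in> space M" for i \<omega>
    using rv[OF that(1)] that(2) by (rule measurable_space)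
  define V where "V \<omega> = (\<Sum>i=1..n. \<psi> (X i \<omega>))" for \<omega>
  have [measurable]: "V \<in> borel_measurable M" unfolding V_def by measurable
  have X_int [simp]: "integrable M (\<lambda>\<omega>. \<psi> (X i \<omega>))" "integrable M (\<lambda>\<omega>. (\<psi> (X i \<omega>))\<^sup>2)" if "i \<ge> 1" for i
    using integrable_distr[OF rv[OF that], of \<psi>] integrable_distr[OF rv[OF that], of "\<lambda>e. (\<psi> e)\<^sup>2"]
      law[OF that] by auto
  have EV: "expectation V = real n * integral\<^sup>L N \<psi>"
    unfolding V_def by (subst Bochner_Integration.integral_sum) (auto simp: integral_comp)
  have "integral\<^sup>L N \<psi> \<le> integral\<^sup>L N \<phi>" by (rule integral_mono) (auto simp: int \<psi>_def)
  then have EV_le: "expectation V \<le> real n * integral\<^sup>L N \<phi>" unfolding EV using n by simp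
  have varV: "variance V \<le> real n * b"
  proof -
    have "variance V = (\<Sum>i=1..n. variance (\<lambda>\<omega>. \<psi> (X i \<omega>)))"
      unfolding V_def using \<psi>_bound X_space
      by (intro indep_vars_variance_sum_bounded[where b="real n"] indep_comp) auto
    also have "\<dots> \<le> (\<Sum>i=1..n. b)"
      by (intro sum_mono, subst variance_eq) (auto simp: b_def integral_comp[where g="\<lambda>e. (\<psi> e)\<^sup>2"])
    finally show ?thesis by simp
  qed
  have V_bound: "\<bar>V \<omega>\<bar> \<le> real n * real n" if "\<omega> \<in> space M" for \<omega>
  proof -
    have "\<bar>V \<omega>\<bar> \<le> (\<Sum>i=1..n. \<bar>\<psi> (X i \<omega>)\<bar>)" unfolding V_def by (rule sum_abs)
    also have "\<dots> \<le> (\<Sum>i=1..n. real n)"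
      using \<psi>_bound X_space that by (intro sum_mono) auto
    finally show ?thesis by simp
  qed
  have "integrable M (\<lambda>\<omega>. (V \<omega>)\<^sup>2)"
    using V_bound by (intro integrable_const_bound[where B="(real n * real n)\<^sup>2"] AE_I2)
      (auto simp: abs_le_square_iff[symmetric])
  then have cheb: "prob {\<omega>\<in>space M. \<bar>V \<omega> - expectation V\<bar> \<ge> real n * c} \<le> 1 / c\<^sup>2 * (b / real n)"
  proof -
    have "prob {\<omega>\<in>space M. \<bar>V \<omega> - expectation V\<bar> \<ge> real n * c} \<le> variance V / (real n * c)\<^sup>2"
      using \<open>integrable M (\<lambda>\<omega>. (V \<omega>)\<^sup>2)\<close> n c by (intro Chebyshev_inequality) auto
    also have "\<dots> \<le> real n * b / (real n * c)\<^sup>2" by (intro divide_right_mono varV) auto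
    also have "\<dots> = 1 / c\<^sup>2 * (b / real n)" using n c by (simp add: power2_eq_square field_simps)
    finally show ?thesis .
  qed
  define A where "A = {e\<in>space N. \<phi> e > real n}"
  have [measurable]: "A \<in> sets N" unfolding A_def by measurable
  \<comment> \<open>On \<open>A\<close> the truncation equals \<open>n\<close>, so this is Markov's
    inequality for its square.\<close>
  have measA: "real n * measure N A \<le> b / real n"
  proof -
    have "(real n)\<^sup>2 * measure N A = (\<integral>e. (real n)\<^sup>2 * indicator A e \<partial>N)" by simp
    also have "\<dots> \<le> b" unfolding b_def
      using \<psi>2_int by (intro integral_mono) (auto simp: A_def \<psi>_def N.emeasure_eq_measure split: split_indicator)
    finally show ?thesis using n by (simp add: field_simps power2_eq_square)
  qed
  let ?Bad = "{\<omega>\<in>space M. (\<Sum>i=1..n. \<phi> (X i \<omega>)) \<ge> real n * (integral\<^sup>L N \<phi> + c)}"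
  let ?Big = "\<Union>i\<in>{1..n}. X i -` A \<inter> space M"
  let ?Dev = "{\<omega>\<in>space M. \<bar>V \<omega> - expectation V\<bar> \<ge> real n * c}"
  \<comment> \<open>If no value exceeds \<open>n\<close>, then \<open>V\<close> is the original sum;
    as truncation does not raise the mean, \<open>V\<close> exceeds its expectation by at least
    \<open>n * c\<close>.\<close>
  have "?Bad \<subseteq> ?Big \<union> ?Dev"
  proof
    fix \<omega> assume \<omega>: "\<omega> \<in> ?Bad"
    show "\<omega> \<in> ?Big \<union> ?Dev"
    proof (cases "\<omega> \<in> ?Big")
      case False
      then have "\<phi> (X i \<omega>) \<le> real n" if "i \<in> {1..n}" for i
        using that \<omega> X_space[of i \<omega>] by (auto simp: A_def not_less)
      then have "V \<omega> = (\<Sum>i=1..n. \<phi> (X i \<omega>))" unfolding V_def \<psi>_def by (intro sum.cong) auto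
      with \<omega> EV_le show ?thesis by (auto simp: algebra_simps)
    qed simp
  qed
  then have "prob ?Bad \<le> prob (?Big \<union> ?Dev)" by (intro finite_measure_mono) measurable
  also have "\<dots> \<le> prob ?Big + prob ?Dev" by (intro measure_Un_le) measurable
  also have "prob ?Big \<le> (\<Sum>i=1..n. prob (X i -` A \<inter> space M))"
    by (intro finite_measure_subadditive_finite) (auto intro!: measurable_sets[OF rv])
  also have "\<dots> = real n * measure N A" by (simp add: prob_comp)
  finally have "prob ?Bad \<le> (1 + 1 / c\<^sup>2) * (b / real n)"
    using measA cheb unfolding distrib_right by linarith
  then show ?thesis by (simp add: n b_def \<psi>_def flip: n_def)
qed

text \<open>Borel-Cantelli applies along powers of 2 because the truncated second moments are
  summable. Partial sums of nonnegative terms increase, so a general \<open>n\<close> is compared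
  with the next power of 2, which is below \<open>2 * n\<close>.\<close>

lemma strong_law_upper_bound:
  fixes \<phi> :: "'e \<Rightarrow> real"
  assumes int: "integrable N \<phi>" and nonneg: "\<And>e. e \<in> space N \<Longrightarrow> 0 \<le> \<phi> e" and c: "c > 0"
  shows "AE \<omega> in M. eventually (\<lambda>n. (\<Sum>i=1..n. \<phi> (X i \<omega>)) \<le> real n * (2 * integral\<^sup>L N \<phi> + c)) sequentially"
proof -
  interpret N: prob_space N by (rule prob_space_N)
  \<comment> \<open>The margin is \<open>c / 2\<close> because the passage from dyadic to general
    times doubles it.\<close>
  define B where "B k = {\<omega>\<in>space M. (\<Sum>i=1..2^k. \<phi> (X i \<omega>)) \<ge> 2 ^ k * (integral\<^sup>L N \<phi> + c / 2)}" for k :: nat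
  have \<phi> [measurable]: "\<phi> \<in> borel_measurable N" using int by simp
  have [measurable]: "X i \<in> measurable M N" if "i \<in> {1..n}" for i n using that by simp
  have B [measurable]: "B k \<in> sets M" for k unfolding B_def by measurable
  define b where "b k = (\<integral>e. (min (\<phi> e) (2 ^ k))\<^sup>2 / 2 ^ k \<partial>N)" for k :: nat
  have b_int: "integrable N (\<lambda>e. (min (\<phi> e) (2 ^ k))\<^sup>2 / 2 ^ k)" for k :: nat
    using nonneg by (intro N.integrable_const_bound[where B="(2 ^ k)\<^sup>2 / 2 ^ k"] AE_I2)
      (auto intro!: divide_right_mono power_mono)
  have b0: "0 \<le> b k" for k unfolding b_def by (intro integral_nonneg_AE AE_I2) auto
  have "(\<Sum>k<n. b k) \<le> 6 * integral\<^sup>L N \<phi>" for n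
  proof -
    have "(\<Sum>k<n. b k) = (\<integral>e. (\<Sum>k<n. (min (\<phi> e) (2 ^ k))\<^sup>2 / 2 ^ k) \<partial>N)"
      unfolding b_def using b_int by (intro Bochner_Integration.integral_sum[symmetric]) auto
    also have "\<dots> \<le> (\<integral>e. 6 * \<phi> e \<partial>N)"
      using b_int int nonneg by (intro integral_mono dyadic_truncation_sum_le) auto
    finally show ?thesis using int by simp
  qed
  then have "summable b" by (intro bounded_imp_summable[where B="6 * integral\<^sup>L N \<phi>"] b0)
      (metis lessThan_Suc_atMost)
  then have "summable (\<lambda>k. (1 + 1 / (c / 2)\<^sup>2) * b k)" by (rule summable_mult)
  then have "summable (\<lambda>k. prob (B k))"
    by (rule summable_comparison_test')
      (use prob_dyadic_sum_le[OF int nonneg, of "c / 2"] c in \<open>auto simp: B_def b_def\<close>)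
  then have "AE \<omega> in M. eventually (\<lambda>k. \<omega> \<in> space M - B k) sequentially"
    by (intro borel_cantelli_AE1) (auto simp: emeasure_eq_measure)
  then show ?thesis
  proof (rule AE_mp, intro AE_I2 impI)
    fix \<omega> assume \<omega>: "\<omega> \<in> space M" and "eventually (\<lambda>k. \<omega> \<in> space M - B k) sequentially"
    then obtain K where K: "\<And>k. k \<ge> K \<Longrightarrow> \<omega> \<notin> B k" by (auto simp: eventually_sequentially)
    have \<phi>0: "0 \<le> \<phi> (X i \<omega>)" if "i \<ge> 1" for i
      using nonneg measurable_space[OF rv[OF that] \<omega>] by blast
    have "(\<Sum>i=1..n. \<phi> (X i \<omega>)) \<le> real n * (2 * integral\<^sup>L N \<phi> + c)" if n: "n \<ge> 2 ^ K + 2" for n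
    proof -
      \<comment> \<open>\<open>n \<ge> 2\<close> allows a power of 2 strictly below
        \<open>n\<close>, and \<open>n > 2 ^ K\<close> makes \<open>k + 1\<close> at least
        \<open>K\<close>, so the good event at level \<open>k + 1\<close> applies.\<close>
      obtain k where k: "2 ^ k < n" "n \<le> 2 ^ (k + 1)" using ex_power_ivl2[of 2 n] n by auto
      have "(2::nat) ^ K < 2 ^ (k + 1)" using k n by linarith
      then have "K \<le> k + 1" using power_less_imp_less_exp[of "2::nat" K "k + 1"] by simp
      then have "\<omega> \<notin> B (k + 1)" by (rule K)
      have "(\<Sum>i=1..n. \<phi> (X i \<omega>)) \<le> (\<Sum>i=1..2^(k+1). \<phi> (X i \<omega>))"
        using k(2) \<phi>0 by (intro sum_mono2) auto
      also have "\<dots> \<le> 2 ^ (k + 1) * (integral\<^sup>L N \<phi> + c / 2)"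
        using \<open>\<omega> \<notin> B (k + 1)\<close> \<omega> unfolding B_def by auto
      also have "\<dots> \<le> (2 * real n) * (integral\<^sup>L N \<phi> + c / 2)"
      proof (rule mult_right_mono)
        have "real (2 ^ k) < real n" using k(1) by (simp only: of_nat_less_iff)
        then show "2 ^ (k + 1) \<le> 2 * real n" by simp
        show "0 \<le> integral\<^sup>L N \<phi> + c / 2"
          using c nonneg by (intro add_nonneg_nonneg integral_nonneg_AE AE_I2) auto
      qed
      finally show ?thesis by (simp add: algebra_simps)
    qed
    then show "eventually (\<lambda>n. (\<Sum>i=1..n. \<phi> (X i \<omega>)) \<le> real n * (2 * integral\<^sup>L N \<phi> + c)) sequentially"
      unfolding eventually_sequentially by blast
  qed
qed

text \<open>Induction over Bochner integrable functions. In the limit step the averaged error of an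
  approximant \<open>s i\<close> is bounded by about twice its mean distance to \<open>f\<close>;
  this loss is harmless since that distance tends to 0.\<close>

theorem strong_law:
  fixes g :: "'e \<Rightarrow> 'b::{banach, second_countable_topology}"
  assumes "integrable N g"
  shows "AE \<omega> in M. (\<lambda>n. (1 / real n) *\<^sub>R (\<Sum>i=1..n. g (X i \<omega>))) \<longlonglongrightarrow> integral\<^sup>L N g"
  using assms
proof (induction g rule: integrable_induct)
  case (base A c)
  interpret N: prob_space N by (rule prob_space_N)
  show ?case using strong_law_indicator[OF base(1)]
  proof eventually_elim
    case (elim \<omega>)
    then have "(\<lambda>n. ((\<Sum>i=1..n. indicator A (X i \<omega>)) / real n) *\<^sub>R c) \<longlonglongrightarrow> measure N A *\<^sub>R c"
      by (intro tendsto_intros)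
    then show ?case using base by (simp add: scaleR_sum_left[symmetric])
  qed
next
  case (add f g)
  show ?case using add(3,4)
  proof eventually_elim
    case (elim \<omega>)
    from tendsto_add[OF this] show ?case
      using add(1,2) by (simp add: sum.distrib scaleR_add_right)
  qed
next
  case (lim f s)
  define E where "E i = (\<integral>e. norm (f e - s i e) \<partial>N)" for i
  have int_diff: "integrable N (\<lambda>e. f e - s i e)" for i using lim by auto
  have [measurable]: "f \<in> borel_measurable N" "s i \<in> borel_measurable N" for i using lim by auto
  \<comment> \<open>The dominating function is \<open>3 * norm (f e)\<close> because the
    approximants satisfy \<open>norm (s i e) \<le> 2 * norm (f e)\<close>.\<close>
  have "E \<longlonglongrightarrow> (\<integral>e. 0 \<partial>N)"
    unfolding E_def
  proof (rule integral_dominated_convergence[where w="\<lambda>e. 3 * norm (f e)"])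
    show "AE e in N. (\<lambda>i. norm (f e - s i e)) \<longlonglongrightarrow> 0"
    proof (rule AE_I2)
      fix e assume "e \<in> space N"
      then have "(\<lambda>i. norm (f e - s i e)) \<longlonglongrightarrow> norm (f e - f e)" by (intro tendsto_intros lim(2))
      then show "(\<lambda>i. norm (f e - s i e)) \<longlonglongrightarrow> 0" by simp
    qed
    show "AE e in N. norm (norm (f e - s i e)) \<le> 3 * norm (f e)" for i
    proof (rule AE_I2)
      fix e assume "e \<in> space N"
      then show "norm (norm (f e - s i e)) \<le> 3 * norm (f e)"
        using norm_triangle_ineq4[of "f e" "s i e"] lim(3)[of e i] by simp
    qed
    show "integrable N (\<lambda>e. 3 * norm (f e))" using lim(4) by simp
  qed measurable
  then have E: "E \<longlonglongrightarrow> 0" by simp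
  have "AE \<omega> in M. \<forall>i. eventually (\<lambda>n. (\<Sum>j=1..n. norm (f (X j \<omega>) - s i (X j \<omega>)))
      \<le> real n * (2 * E i + 1 / real (Suc i))) sequentially"
    unfolding AE_all_countable E_def using int_diff by (intro allI strong_law_upper_bound) auto
  moreover have "AE \<omega> in M. \<forall>i. (\<lambda>n. (1 / real n) *\<^sub>R (\<Sum>j=1..n. s i (X j \<omega>))) \<longlonglongrightarrow> integral\<^sup>L N (s i)"
    unfolding AE_all_countable using lim(5) by blast
  ultimately show ?case
  proof eventually_elim
    case (elim \<omega>)
    let ?avg = "\<lambda>h n. (1 / real n) *\<^sub>R (\<Sum>j=1..n. h (X j \<omega>))"
    show ?case
    proof (rule tendstoI)
      fix e :: real assume e: "e > 0"
      \<comment> \<open>Of \<open>3 * E i\<close>, two parts bound the averages of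
        \<open>f - s i\<close> and one the difference of the integrals.\<close>
      have "(\<lambda>i. 3 * E i + 1 / real (Suc i)) \<longlonglongrightarrow> 3 * 0 + 0"
        using LIMSEQ_inverse_real_of_nat by (intro tendsto_intros E) (simp add: inverse_eq_divide)
      then have "eventually (\<lambda>i. 3 * E i + 1 / real (Suc i) < e / 2) sequentially"
        using e by (intro order_tendstoD(2)[where y=0 and a="e / 2"]) auto
      then obtain i where i: "3 * E i + 1 / real (Suc i) < e / 2"
        using eventually_happens by fastforce
      have near: "norm (integral\<^sup>L N (s i) - integral\<^sup>L N f) \<le> E i"
        using integral_norm_bound[of N "\<lambda>e. f e - s i e"] lim(1)[of i] lim(4)
        by (simp add: E_def norm_minus_commute)
      have "eventually (\<lambda>n. norm (?avg f n - ?avg (s i) n) \<le> 2 * E i + 1 / real (Suc i)) sequentially"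
        using elim(1)[rule_format, of i] eventually_gt_at_top[of 0]
      proof eventually_elim
        case (elim n)
        have "norm (?avg f n - ?avg (s i) n) = 1 / real n * norm (\<Sum>j=1..n. f (X j \<omega>) - s i (X j \<omega>))"
          by (simp add: sum_subtractf scaleR_diff_right[symmetric])
        also have "\<dots> \<le> 1 / real n * (\<Sum>j=1..n. norm (f (X j \<omega>) - s i (X j \<omega>)))"
          by (intro mult_left_mono norm_sum) auto
        also have "\<dots> \<le> 1 / real n * (real n * (2 * E i + 1 / real (Suc i)))"
          using elim by (intro mult_left_mono) auto
        finally show ?case using elim(2) by simp
      qed
      moreover have "eventually (\<lambda>n. norm (?avg (s i) n - integral\<^sup>L N (s i)) < e / 2) sequentially"
        using tendstoD[OF elim(2)[rule_format, of i], of "e / 2"] e by (simp add: dist_norm)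
      ultimately show "eventually (\<lambda>n. dist (?avg f n) (integral\<^sup>L N f) < e) sequentially"
      proof eventually_elim
        case (elim n)
        have "dist (?avg f n) (integral\<^sup>L N f) \<le> norm (?avg f n - ?avg (s i) n)
            + norm (?avg (s i) n - integral\<^sup>L N (s i)) + norm (integral\<^sup>L N (s i) - integral\<^sup>L N f)"
          using norm_diff_triangle_le[OF norm_diff_triangle_le[OF order_refl order_refl] order_refl]
          unfolding dist_norm by blast
        then show ?case using elim i near by linarith
      qed
    qed
  qed
qed

end

subsection \<open>Measurable approximate subgradients\<close>

lemma countable_dense_set:
  obtains D :: "'a::second_countable_topology set" where "countable D" "closure D = UNIV"
proof -
  obtain D :: "'a set" where D: "countable D" "\<And>X. open X \<Longrightarrow> X \<noteq> {} \<Longrightarrow> \<exists>d\<in>D. d \<in> X"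
    by (rule countable_dense_setE) blast
  have "- closure D = {}"
    by (rule ccontr) (use D(2)[of "- closure D"] closure_subset[of D] in auto)
  then have "closure D = UNIV" by auto
  with D(1) show ?thesis by (rule that)
qed

text \<open>The proximal point \<open>p\<close> of \<open>z\<close> carries an exact subgradient.
  Moving its base point from \<open>p\<close> to \<open>z\<close> costs at most
  \<open>r * L^2\<close>, and \<open>r\<close> is chosen to make this at most
  \<open>\<epsilon>\<close>.\<close>

lemma exists_approx_subgradient:
  fixes \<phi> :: "'h::{real_inner, banach} \<Rightarrow> real"
  assumes cvx: "convex_on UNIV \<phi>" and lip: "L-lipschitz_on UNIV \<phi>" and e: "\<epsilon> > 0"
  shows "\<exists>g. norm g \<le> L \<and> (\<forall>y. \<phi> z + inner g (y - z) - \<epsilon> \<le> \<phi> y)"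
proof -
  define r where "r = \<epsilon> / (L\<^sup>2 + 1)"
  have r: "r > 0" unfolding r_def using e by (simp add: add_nonneg_pos)
  have L: "0 \<le> L" using lip by (rule lipschitz_on_nonneg)
  have rL: "r * L\<^sup>2 \<le> \<epsilon>"
    unfolding r_def using e by (simp add: divide_le_eq add_nonneg_pos)
  define p where "p = prox r (\<lambda>y. ereal (\<phi> y)) z"
  define g where "g = (1 / r) *\<^sub>R (z - p)"
  have p: "dist z p \<le> r * L" unfolding p_def by (rule dist_prox_le[OF cvx lip r])
  then have "norm g \<le> L" unfolding g_def using r by (simp add: dist_norm pos_divide_le_eq mult.commute)
  moreover have "\<phi> z + inner g (y - z) - \<epsilon> \<le> \<phi> y" for y
  proof -
    have "\<phi> p + inner g (y - p) \<le> \<phi> y"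
      using prox_subgradient[OF cvx lip r, of z y] by (simp add: p_def g_def)
    moreover have "inner g (y - p) = inner g (y - z) + inner g (z - p)" by (simp add: inner_simps)
    moreover have "inner g (z - p) \<ge> 0" using r by (simp add: g_def)
    moreover have "\<phi> z - \<phi> p \<le> L * dist z p"
      using lipschitz_onD[OF lip, of z p] by (auto simp: dist_real_def)
    moreover have "L * dist z p \<le> L * (r * L)" using p L by (rule mult_left_mono)
    ultimately show ?thesis using rL by (simp add: power2_eq_square algebra_simps)
  qed
  ultimately show ?thesis by blast
qed

text \<open>The first good member of a dense sequence is selected. Goodness is tested only against
  countably many \<open>y\<close>, hence measurable; continuity extends it to all \<open>y\<close>.
  The slack 1 in the norm and the term \<open>\<epsilon> * dist y z\<close> pay for replacing a
  subgradient by a nearby member of the sequence.\<close>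

lemma measurable_approx_subgradient:
  fixes f :: "'e \<Rightarrow> 'h::{real_inner, banach, second_countable_topology} \<Rightarrow> real"
  assumes [measurable]: "\<And>y. (\<lambda>e. f e y) \<in> borel_measurable M" "L \<in> borel_measurable M"
    and cvx: "\<And>e. e \<in> space M \<Longrightarrow> convex_on UNIV (f e)"
    and lip: "\<And>e. e \<in> space M \<Longrightarrow> (L e)-lipschitz_on UNIV (f e)"
    and \<epsilon>: "\<epsilon> > 0"
  shows "\<exists>g \<in> borel_measurable M. \<forall>e\<in>space M. norm (g e) \<le> L e + 1 \<and>
    (\<forall>y. f e z + inner (g e) (y - z) - \<epsilon> * (1 + dist y z) \<le> f e y)"
proof -
  obtain D :: "'h set" where D: "countable D" and clD: "closure D = UNIV"
    by (rule countable_dense_set)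
  have D0: "D \<noteq> {}" using clD by auto
  define d where "d = from_nat_into D"
  have d: "range d = D" unfolding d_def using D0 D by (rule range_from_nat_into)
  define Good where "Good e k \<longleftrightarrow> norm (d k) \<le> L e + 1 \<and>
    (\<forall>y\<in>D. f e z + inner (d k) (y - z) - \<epsilon> * (1 + dist y z) \<le> f e y)" for e k
  have Good_meas [measurable]: "Measurable.pred M (\<lambda>e. Good e k)" for k
    unfolding Good_def using D by measurable
  define g where "g e = d (LEAST k. Good e k)" for e
  have "g \<in> borel_measurable M"
    unfolding g_def by (rule measurable_compose[OF measurable_Least]) auto
  moreover have "norm (g e) \<le> L e + 1 \<and>
    (\<forall>y. f e z + inner (g e) (y - z) - \<epsilon> * (1 + dist y z) \<le> f e y)" if e: "e \<in> space M" for e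
  proof -
    obtain g0 where g0: "norm g0 \<le> L e" "\<And>y. f e z + inner g0 (y - z) - \<epsilon> \<le> f e y"
      using exists_approx_subgradient[OF cvx[OF e] lip[OF e] \<epsilon>] by blast
    obtain q where "q \<in> D" "dist q g0 < min \<epsilon> 1"
    proof -
      have "g0 \<in> closure D" "0 < min \<epsilon> 1" using clD \<epsilon> by auto
      then show ?thesis using that by (meson closure_approachable)
    qed
    then obtain k where k: "dist (d k) g0 < min \<epsilon> 1" using d by auto
    have "Good e k"
      unfolding Good_def
    proof (intro conjI ballI)
      show "norm (d k) \<le> L e + 1"
        using g0(1) k norm_triangle_sub[of "d k" g0] by (simp add: dist_norm)
      fix y
      have "inner (d k - g0) (y - z) \<le> \<epsilon> * dist y z"
        using norm_cauchy_schwarz[of "d k - g0" "y - z"] k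
          mult_right_mono[of "norm (d k - g0)" \<epsilon> "norm (y - z)"] by (simp add: dist_norm)
      then show "f e z + inner (d k) (y - z) - \<epsilon> * (1 + dist y z) \<le> f e y"
        using g0(2)[of y] by (simp add: inner_diff_left algebra_simps)
    qed
    then have good: "Good e (LEAST k. Good e k)" by (rule LeastI)
    have "continuous_on UNIV (f e)" using lip[OF e] by (rule lipschitz_on_continuous_on)
    then have "closed {y. f e z + inner (g e) (y - z) - \<epsilon> * (1 + dist y z) \<le> f e y}"
      by (intro closed_Collect_le continuous_intros)
    moreover have "D \<subseteq> {y. f e z + inner (g e) (y - z) - \<epsilon> * (1 + dist y z) \<le> f e y}"
      using good unfolding Good_def g_def by blast
    ultimately have "{y. f e z + inner (g e) (y - z) - \<epsilon> * (1 + dist y z) \<le> f e y} = UNIV"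
      using closure_minimal clD by blast
    with good show ?thesis unfolding Good_def g_def by blast
  qed
  ultimately show ?thesis by blast
qed

subsection \<open>Convergence of consistent schemes\<close>

text \<open>
  \<open>w N k\<close> is the \<open>k\<close>-th iterate with step \<open>t / N\<close>, and \<open>G m z\<close> a \<open>1 / m\<close>-subgradient of the limit
  function at \<open>z\<close>. How large \<open>N\<close> must be may depend on \<open>m\<close> and \<open>z\<close>; for the random scheme the law of large
  numbers gives no more than this, and only for countably many \<open>z\<close>.
\<close>

definition consistent_scheme ::
    "'h::real_inner set \<Rightarrow> (nat \<Rightarrow> 'h \<Rightarrow> 'h) \<Rightarrow> real \<Rightarrow> real \<Rightarrow> (nat \<Rightarrow> nat \<Rightarrow> 'h) \<Rightarrow> bool" where
  "consistent_scheme D G C t w \<longleftrightarrow> (\<forall>m\<ge>1. \<forall>z\<in>D. \<forall>\<^sub>F N in sequentially. \<forall>k<N.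
     dist (w N k) (w N (Suc k)) \<le> t / real N * C \<and>
     (dist (w N (Suc k)) z)\<^sup>2 \<le> (dist (w N k) z)\<^sup>2
       - 2 * (t / real N) * inner (G m z) (w N k - z)
       + 2 * (t / real N) / real m * (1 + 2 * dist (w N k) z) + 2 * (t / real N)\<^sup>2 * C\<^sup>2)"

text \<open>To any accuracy, both schemes end near the endpoint of one Euler scheme that refers to
  neither of them; so one sequence is Cauchy and the other follows it.\<close>

lemma consistent_schemes_converge:
  fixes D :: "'h::{real_inner, banach} set"
  assumes t: "t > 0" and C: "C \<ge> 0" and D: "closure D = UNIV"
    and G: "\<And>m z. m \<ge> 1 \<Longrightarrow> z \<in> D \<Longrightarrow> norm (G m z) \<le> C"
    and v: "consistent_scheme D G C t v" "\<And>N. v N 0 = x"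
    and w: "consistent_scheme D G C t w" "\<And>N. w N 0 = x"
  shows "\<exists>p. (\<lambda>N. v N N) \<longlonglongrightarrow> p \<and> (\<lambda>N. w N N) \<longlonglongrightarrow> p"
proof -
  \<comment> \<open>\<open>q\<close> is chosen before \<open>u\<close>: this order of quantifiers
    lets two schemes share it.\<close>
  have approx: "\<exists>q. \<forall>u. consistent_scheme D G C t u \<longrightarrow> (\<forall>N. u N 0 = x) \<longrightarrow>
      (\<forall>\<^sub>F N in sequentially. dist (u N N) q < e)" if e: "e > 0" for e
  proof -
    obtain m :: nat where m: "m \<ge> 1" "euler_const t C / real m < e\<^sup>2"
    proof -
      have "(\<lambda>m. euler_const t C / real m) \<longlonglongrightarrow> 0" by (rule lim_const_over_n)
      then have "\<forall>\<^sub>F m in sequentially. euler_const t C / real m < e\<^sup>2"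
        using e by (intro order_tendstoD(2)[where y=0]) auto
      then have "\<forall>\<^sub>F m in sequentially. m \<ge> 1 \<and> euler_const t C / real m < e\<^sup>2"
        using eventually_ge_at_top[of 1] by eventually_elim simp
      then show ?thesis using that by (auto dest: eventually_happens)
    qed
    have "\<exists>d\<in>D. dist d y \<le> 1 / (real m)\<^sup>2" for y
    proof -
      have "y \<in> closure D" "0 < 1 / (real m)\<^sup>2" using D m by auto
      then show ?thesis by (meson closure_approachable less_imp_le)
    qed
    then obtain c where c: "\<And>y. c y \<in> D" "\<And>y. dist (c y) y \<le> 1 / (real m)\<^sup>2" by metis
    \<comment> \<open>Every explicit Euler step is rounded into \<open>D\<close>, where consistency
      is known, at a cost of \<open>1 / m^2\<close>.\<close>
    define z where "z = rec_nat (c x) (\<lambda>_ y. c (y - (t / real m) *\<^sub>R G m y))"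
    have z0: "z 0 = c x" and zS: "z (Suc j) = c (z j - (t / real m) *\<^sub>R G m (z j))" for j
      by (simp_all add: z_def)
    have zD: "z j \<in> D" for j by (cases j) (simp_all add: z0 zS c)
    have "\<forall>\<^sub>F N in sequentially. dist (u N N) (z m) < e"
      if u: "consistent_scheme D G C t u" "\<forall>N. u N 0 = x" for u
    proof -
      \<comment> \<open>For fixed \<open>m\<close> only the finitely many points \<open>z j\<close>
        with \<open>j < m\<close> are involved, so their thresholds for \<open>N\<close> have a
        common bound.\<close>
      have "\<forall>\<^sub>F N in sequentially. \<forall>j\<in>{..<m}. \<forall>k<N.
          dist (u N k) (u N (Suc k)) \<le> t / real N * C \<and>
          (dist (u N (Suc k)) (z j))\<^sup>2 \<le> (dist (u N k) (z j))\<^sup>2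
            - 2 * (t / real N) * inner (G m (z j)) (u N k - z j)
            + 2 * (t / real N) / real m * (1 + 2 * dist (u N k) (z j)) + 2 * (t / real N)\<^sup>2 * C\<^sup>2"
        using u(1) m(1) zD unfolding consistent_scheme_def
        by (intro eventually_ball_finite) auto
      then show ?thesis using eventually_ge_at_top[of "m\<^sup>2"]
      proof eventually_elim
        case (elim N)
        have "(dist (u N N) (z m))\<^sup>2 \<le> euler_const t C / real m"
        proof (rule euler_comparison[OF t C m(1) elim(2), where x="u N" and z=z and G="\<lambda>j. G m (z j)"])
          show "dist (u N 0) (z 0) \<le> 1 / (real m)\<^sup>2"
            using c(2)[of x] u(2) by (simp add: z0 dist_commute)
          show "dist (z (Suc j)) (z j - (t / real m) *\<^sub>R G m (z j)) \<le> 1 / (real m)\<^sup>2" for j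
            unfolding zS by (rule c(2))
          show "norm (G m (z j)) \<le> C" for j using G m(1) zD by blast
          show "dist (u N k) (u N (Suc k)) \<le> t / real N * C" if "k < N" for k
            using elim(1)[rule_format, of 0 k] that m(1) by simp
          show "(dist (u N (Suc k)) (z j))\<^sup>2 \<le> (dist (u N k) (z j))\<^sup>2
              - 2 * (t / real N) * inner (G m (z j)) (u N k - z j)
              + 2 * (t / real N) / real m * (1 + 2 * dist (u N k) (z j)) + 2 * (t / real N)\<^sup>2 * C\<^sup>2"
            if "k < N" "j < m" for k j
            using elim(1)[rule_format, of j k] that by simp
        qed
        then have "(dist (u N N) (z m))\<^sup>2 < e\<^sup>2" using m(2) by simp
        then show ?case using e by (simp add: power_less_imp_less_base)
      qed
    qed
    then show ?thesis by blast
  qed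
  have both: "\<exists>q. (\<forall>\<^sub>F N in sequentially. dist (v N N) q < e) \<and> (\<forall>\<^sub>F N in sequentially. dist (w N N) q < e)"
    if "e > 0" for e using approx[OF that] v w by blast
  have "Cauchy (\<lambda>N. v N N)"
  proof (rule metric_CauchyI)
    fix e :: real assume "e > 0"
    then obtain q where "\<forall>\<^sub>F N in sequentially. dist (v N N) q < e / 2" using both[of "e / 2"] by auto
    then obtain K where K: "\<And>N. N \<ge> K \<Longrightarrow> dist (v N N) q < e / 2" by (auto simp: eventually_sequentially)
    then have "\<forall>m\<ge>K. \<forall>n\<ge>K. dist (v m m) (v n n) < e"
      using dist_triangle_half_l by blast
    then show "\<exists>K. \<forall>m\<ge>K. \<forall>n\<ge>K. dist (v m m) (v n n) < e" ..
  qed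
  then obtain p where p: "(\<lambda>N. v N N) \<longlonglongrightarrow> p" by (auto simp: Cauchy_convergent_iff convergent_def)
  have "(\<lambda>N. w N N) \<longlonglongrightarrow> p"
  proof (rule tendstoI)
    fix e :: real assume e: "e > 0"
    then obtain q where q: "\<forall>\<^sub>F N in sequentially. dist (v N N) q < e / 3" "\<forall>\<^sub>F N in sequentially. dist (w N N) q < e / 3"
      using both[of "e / 3"] by auto
    have "\<forall>\<^sub>F N in sequentially. dist (v N N) p < e / 3" using p e by (intro tendstoD) auto
    with q show "\<forall>\<^sub>F N in sequentially. dist (w N N) p < e"
    proof eventually_elim
      case (elim N)
      then show ?case
        using dist_triangle[of "w N N" p q] dist_triangle[of q p "v N N"] by (simp add: dist_commute)
    qed
  qed
  with p show ?thesis by blast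
qed

text \<open>\<open>\<nu> N\<close> is the number of proximal maps in a round: \<open>N\<close> for
  the random scheme and 1 for the proximal iterates of the integral functional, so that one argument
  covers both.\<close>

lemma consistent_scheme_prox_cycle:
  fixes \<phi> :: "nat \<Rightarrow> 'h::{real_inner, banach} \<Rightarrow> real"
  assumes t: "t > 0" and \<nu>: "\<And>N. N \<ge> 1 \<Longrightarrow> \<nu> N \<ge> 1"
    and cvx: "\<And>i. i \<ge> 1 \<Longrightarrow> convex_on UNIV (\<phi> i)"
    and lip: "\<And>i. i \<ge> 1 \<Longrightarrow> (L i)-lipschitz_on UNIV (\<phi> i)"
    and L: "\<forall>\<^sub>F N in sequentially. (\<Sum>i=1..\<nu> N. L i) \<le> real (\<nu> N) * C"
    and \<gamma>: "\<And>m z. m \<ge> 1 \<Longrightarrow> z \<in> D \<Longrightarrow> \<forall>\<^sub>F N in sequentially.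
      norm ((1 / real (\<nu> N)) *\<^sub>R (\<Sum>i=1..\<nu> N. \<gamma> m z i) - G m z) \<le> 1 / real m"
    and sub: "\<And>m z i y. m \<ge> 1 \<Longrightarrow> z \<in> D \<Longrightarrow> i \<ge> 1 \<Longrightarrow>
      \<phi> i z + inner (\<gamma> m z i) (y - z) - 1 / real m * (1 + dist y z) \<le> \<phi> i y"
  shows "consistent_scheme D G C t
    (\<lambda>N k. (prox_cycle (t / real N / real (\<nu> N)) (\<nu> N) (\<lambda>i y. ereal (\<phi> i y)) ^^ k) x)"
  unfolding consistent_scheme_def
proof (intro allI impI ballI)
  fix m :: nat and z assume m: "m \<ge> 1" and z: "z \<in> D"
  let ?w = "\<lambda>N k. (prox_cycle (t / real N / real (\<nu> N)) (\<nu> N) (\<lambda>i y. ereal (\<phi> i y)) ^^ k) x"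
  show "\<forall>\<^sub>F N in sequentially. \<forall>k<N. dist (?w N k) (?w N (Suc k)) \<le> t / real N * C \<and>
     (dist (?w N (Suc k)) z)\<^sup>2 \<le> (dist (?w N k) z)\<^sup>2
       - 2 * (t / real N) * inner (G m z) (?w N k - z)
       + 2 * (t / real N) / real m * (1 + 2 * dist (?w N k) z) + 2 * (t / real N)\<^sup>2 * C\<^sup>2"
    using L \<gamma>[OF m z] eventually_ge_at_top[of 1]
  proof eventually_elim
    case (elim N)
    define n where "n = real (\<nu> N)"
    define h where "h = t / real N"
    define \<Lambda> where "\<Lambda> = (\<Sum>i=1..\<nu> N. L i)"
    define g where "g = (\<Sum>i=1..\<nu> N. \<gamma> m z i)"
    have n: "n \<ge> 1" unfolding n_def using \<nu>[OF elim(3)] by simp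
    have h: "h > 0" unfolding h_def using t elim(3) by simp
    have r: "h / n > 0" using h n by simp
    have \<Lambda>0: "0 \<le> \<Lambda>" unfolding \<Lambda>_def by (intro sum_nonneg lipschitz_on_nonneg[OF lip]) auto
    have \<Lambda>: "\<Lambda> \<le> n * C" using elim(1) by (simp add: \<Lambda>_def n_def)
    have g: "norm ((1 / n) *\<^sub>R g - G m z) \<le> 1 / real m" using elim(2) by (simp add: g_def n_def)
    have "dist (?w N k) (?w N (Suc k)) \<le> h * C \<and> (dist (?w N (Suc k)) z)\<^sup>2 \<le> (dist (?w N k) z)\<^sup>2
       - 2 * h * inner (G m z) (?w N k - z) + 2 * h / real m * (1 + 2 * dist (?w N k) z) + 2 * h\<^sup>2 * C\<^sup>2" for k
    proof -
      define a where "a = ?w N k"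
      define b where "b = ?w N (Suc k)"
      have b: "b = prox_cycle (h / n) (\<nu> N) (\<lambda>i y. ereal (\<phi> i y)) a"
        by (simp add: b_def a_def h_def n_def)
      note step = prox_cycle_step[where n="\<nu> N" and \<phi>=\<phi> and L=L and r="h / n" and \<gamma>="\<gamma> m z"
          and e="1 / real m * (1 + dist a z)" and x=a and z=z, OF cvx lip r sub[OF m z],
          folded b \<Lambda>_def g_def n_def, simplified]
      have "h / n * \<Lambda> \<le> h / n * (n * C)" using \<Lambda> r by (intro mult_left_mono) auto
      also have "\<dots> = h * C" using n by simp
      finally have hC: "h / n * \<Lambda> \<le> h * C" .
      have "(h / n * \<Lambda>)\<^sup>2 \<le> (h * C)\<^sup>2"
        using hC mult_nonneg_nonneg[OF less_imp_le[OF r] \<Lambda>0] by (rule power_mono)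
      then have sq: "2 * (h / n)\<^sup>2 * \<Lambda>\<^sup>2 \<le> 2 * h\<^sup>2 * C\<^sup>2" by (simp add: power_mult_distrib power_divide)
      have "- inner ((1 / n) *\<^sub>R g - G m z) (a - z) \<le> 1 / real m * dist a z"
        using Cauchy_Schwarz_ineq2[of "(1 / n) *\<^sub>R g - G m z" "a - z"]
          mult_right_mono[OF g, of "norm (a - z)"] by (simp add: dist_norm)
      then have "h * (inner (G m z) (a - z) - inner g (a - z) / n) \<le> h * (1 / real m * dist a z)"
        using h by (intro mult_left_mono) (auto simp: inner_diff_left)
      then have inn: "- (2 * (h / n) * inner g (a - z)) \<le> - 2 * h * inner (G m z) (a - z) + 2 * h * (1 / real m * dist a z)"
        unfolding right_diff_distrib[of h] by simp
      \<comment> \<open>One \<open>dist a z / m\<close> comes from the approximate subgradients, the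
        other from replacing their average by \<open>G m z\<close>; this explains the factor 2 in
        \<open>consistent_scheme\<close>.\<close>
      have split: "2 * h / real m * (1 + 2 * dist a z)
          = 2 * h * (1 / real m * (1 + dist a z)) + 2 * h * (1 / real m * dist a z)"
        using m by (simp add: divide_simps) (simp add: algebra_simps)
      have "dist a b \<le> h * C"
        using step(1) hC by (auto intro: order_trans)
      moreover have "(dist b z)\<^sup>2 \<le> (dist a z)\<^sup>2 - 2 * (h / n) * inner g (a - z)
          + 2 * h * (1 / real m * (1 + dist a z)) + 2 * (h / n)\<^sup>2 * \<Lambda>\<^sup>2"
        using step(2) n by simp
      then have "(dist b z)\<^sup>2 \<le> (dist a z)\<^sup>2 - 2 * h * inner (G m z) (a - z)
          + 2 * h / real m * (1 + 2 * dist a z) + 2 * h\<^sup>2 * C\<^sup>2"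
        using sq inn split by linarith
      ultimately show ?thesis by (simp add: a_def b_def)
    qed
    then show ?case unfolding h_def by blast
  qed
qed

subsection \<open>Integral functionals\<close>

lemma ereal_integral_eq_integral:
  assumes f: "\<And>e. e \<in> space M \<Longrightarrow> f e = ereal (g e)" and int: "integrable M g"
  shows "ereal_integral M f = ereal (integral\<^sup>L M g)"
proof -
  have "(\<integral>\<^sup>+ e. e2ennreal (f e) \<partial>M) = (\<integral>\<^sup>+ e. ennreal (g e) \<partial>M)"
    "(\<integral>\<^sup>+ e. e2ennreal (- f e) \<partial>M) = (\<integral>\<^sup>+ e. ennreal (- g e) \<partial>M)"
    by (auto intro!: nn_integral_cong simp: f ennreal.abs_eq e2ennreal_def)
  moreover have "(\<integral>\<^sup>+ e. ennreal (g e) \<partial>M) < \<infinity>" "(\<integral>\<^sup>+ e. ennreal (- g e) \<partial>M) < \<infinity>"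
    using int unfolding real_integrable_def by (auto simp: less_top)
  moreover have "enn2ereal p = ereal (enn2real p)" if "p < \<infinity>" for p
    using that by (cases p) auto
  ultimately show ?thesis
    unfolding ereal_integral_def real_lebesgue_integral_def[OF int] by simp
qed

lemma finite_if_dominated_self_difference:
  assumes "\<bar>(a::ereal) - a\<bar> \<le> ereal c"
  shows "\<bar>a\<bar> \<noteq> \<infinity>"
  using assms by (cases a) auto

text \<open>The epigraph of \<open>f e\<close> meets the closed half-line
  \<open>{y} \<times> {..a}\<close> exactly when \<open>g e \<le> a\<close>, so measurability of the
  epigraphs yields that of the sublevel sets of \<open>g\<close>.\<close>

lemma borel_measurable_if_normal_integrand:
  fixes f :: "'e \<Rightarrow> 'h::t1_space \<Rightarrow> ereal"
  assumes "normal_integrand M f" and f: "\<And>e. e \<in> space M \<Longrightarrow> f e y = ereal (g e)"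
  shows "g \<in> borel_measurable M"
  unfolding borel_measurable_iff_le
proof
  fix a :: real
  have "closed ({y} \<times> {..a})" by (intro closed_Times) auto
  then have "{e \<in> space M. epi (f e) \<inter> ({y} \<times> {..a}) \<noteq> {}} \<in> sets M"
    using assms(1) unfolding normal_integrand_def measurable_set_valued_def by blast
  also have "{e \<in> space M. epi (f e) \<inter> ({y} \<times> {..a}) \<noteq> {}} = {e \<in> space M. g e \<le> a}"
  proof (intro Collect_cong conj_cong refl)
    fix e assume e: "e \<in> space M"
    have "epi (f e) \<inter> ({y} \<times> {..a}) = Pair y ` {g e..a}" by (auto simp: epi_def f[OF e])
    then show "epi (f e) \<inter> ({y} \<times> {..a}) \<noteq> {} \<longleftrightarrow> g e \<le> a" by simp
  qed
  finally show "{e \<in> space M. g e \<le> a} \<in> sets M" .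
qed

lemma convex_on_if_convex_fun:
  assumes "convex_fun (\<lambda>x. ereal (g x))"
  shows "convex_on UNIV g"
proof (rule convex_onI)
  fix t :: real and x y assume t: "0 < t" "t < 1"
  have "ereal (g ((1 - t) *\<^sub>R x + (1 - (1 - t)) *\<^sub>R y)) \<le> ereal (1 - t) * ereal (g x) + ereal (1 - (1 - t)) * ereal (g y)"
    using assms t unfolding convex_fun_def by (metis (no_types, lifting) diff_gt_0_iff_gt diff_less_eq greaterThanLessThan_iff less_add_same_cancel1)
  then show "g ((1 - t) *\<^sub>R x + t *\<^sub>R y) \<le> (1 - t) * g x + t * g y" by simp
qed simp

lemma convex_on_integral:
  fixes f :: "'e \<Rightarrow> 'h::real_vector \<Rightarrow> real"
  assumes "\<And>e. e \<in> space M \<Longrightarrow> convex_on UNIV (f e)" and [simp]: "\<And>x. integrable M (\<lambda>e. f e x)"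
  shows "convex_on UNIV (\<lambda>x. \<integral>e. f e x \<partial>M)"
proof (rule convex_onI)
  fix t :: real and x y assume t: "0 < t" "t < 1"
  have "(\<integral>e. f e ((1 - t) *\<^sub>R x + t *\<^sub>R y) \<partial>M) \<le> (\<integral>e. (1 - t) * f e x + t * f e y \<partial>M)"
    using t by (intro integral_mono) (auto intro!: convex_onD[OF assms(1)])
  then show "(\<integral>e. f e ((1 - t) *\<^sub>R x + t *\<^sub>R y) \<partial>M) \<le> (1 - t) * (\<integral>e. f e x \<partial>M) + t * (\<integral>e. f e y \<partial>M)"
    by simp
qed simp

lemma lipschitz_on_integral:
  fixes f :: "'e \<Rightarrow> 'h::metric_space \<Rightarrow> real"
  assumes lip: "\<And>e. e \<in> space M \<Longrightarrow> (L e)-lipschitz_on UNIV (f e)" and L: "integrable M L"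
    and [simp]: "\<And>x. integrable M (\<lambda>e. f e x)"
  shows "(integral\<^sup>L M L)-lipschitz_on UNIV (\<lambda>x. \<integral>e. f e x \<partial>M)"
proof (rule lipschitz_onI)
  show "0 \<le> integral\<^sup>L M L" by (intro integral_nonneg_AE AE_I2 lipschitz_on_nonneg[OF lip])
  fix x y
  have "dist (\<integral>e. f e x \<partial>M) (\<integral>e. f e y \<partial>M) = norm (\<integral>e. f e x - f e y \<partial>M)"
    by (simp add: dist_norm)
  also have "\<dots> \<le> (\<integral>e. norm (f e x - f e y) \<partial>M)" by (rule integral_norm_bound)
  also have "\<dots> \<le> (\<integral>e. L e * dist x y \<partial>M)"
    using L lipschitz_onD[OF lip, of _ x y] by (intro integral_mono) (auto simp: dist_norm)
  finally show "dist (\<integral>e. f e x \<partial>M) (\<integral>e. f e y \<partial>M) \<le> integral\<^sup>L M L * dist x y" by simp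
qed

section \<open>Almost sure convergence for real-valued integrands\<close>

text \<open>The common limit \<open>p\<close> is part of the claim because
  \<open>gradient_flow\<close> is a \<open>lim\<close>, informative only once convergence is shown.
  A single null set serves all \<open>t\<close> and \<open>x\<close>, as randomness enters only
  through averages of \<open>L\<close> and of the subgradients selected for countably many points
  and accuracies.\<close>

lemma (in prob_space) prox_cycle_iterates_converge:
  fixes f :: "'e \<Rightarrow> 'h::{real_inner, banach, second_countable_topology} \<Rightarrow> real"
  assumes iid: "iid_with_law M \<mu> \<xi>"
    and cvx: "\<And>e. e \<in> space \<mu> \<Longrightarrow> convex_on UNIV (f e)"
    and lip: "\<And>e. e \<in> space \<mu> \<Longrightarrow> (L e)-lipschitz_on UNIV (f e)"
    and L: "integrable \<mu> L" and f: "\<And>y. integrable \<mu> (\<lambda>e. f e y)"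
  shows "AE \<omega> in M. \<forall>t>0. \<forall>x. \<exists>p.
    (\<lambda>n. (prox_cycle (t / (real n)\<^sup>2) n (\<lambda>i y. ereal (f (\<xi> i \<omega>) y)) ^^ n) x) \<longlonglongrightarrow> p \<and>
    (\<lambda>n. (prox (t / real n) (\<lambda>y. ereal (\<integral>e. f e y \<partial>\<mu>)) ^^ n) x) \<longlonglongrightarrow> p"
proof -
  interpret iid_sequence M \<mu> \<xi>
    using iid unfolding iid_with_law_def by unfold_locales auto
  interpret \<mu>: prob_space \<mu> by (rule prob_space_N)
  define F where "F y = (\<integral>e. f e y \<partial>\<mu>)" for y
  define \<Lambda> where "\<Lambda> = integral\<^sup>L \<mu> L"
  \<comment> \<open>The constant that \<open>strong_law_upper_bound\<close> gives for averages of
    \<open>L\<close> with margin 1; it also dominates the Lipschitz constant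
    \<open>\<Lambda>\<close> of \<open>F\<close> and the norms of \<open>G m z\<close>.\<close>
  define C where "C = 2 * \<Lambda> + 1"
  have L0: "0 \<le> L e" if "e \<in> space \<mu>" for e using lip[OF that] by (rule lipschitz_on_nonneg)
  then have \<Lambda>0: "0 \<le> \<Lambda>" unfolding \<Lambda>_def by (intro integral_nonneg_AE AE_I2)
  obtain D :: "'h set" where D: "countable D" and clD: "closure D = UNIV"
    by (rule countable_dense_set)
  define Q where "Q m z h \<longleftrightarrow> h \<in> borel_measurable \<mu> \<and> (\<forall>e\<in>space \<mu>. norm (h e) \<le> L e + 1 \<and>
      (\<forall>y. f e z + inner (h e) (y - z) - 1 / real m * (1 + dist y z) \<le> f e y))" for m :: nat and z h
  \<comment> \<open>The selection is fixed before any \<open>\<omega>\<close> is considered, since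
    the strong law is applied to each \<open>g m z\<close> separately.\<close>
  define g where "g m z = (SOME h. Q m z h)" for m z
  have Q: "Q m z (g m z)" if m: "m \<ge> 1" for m z
  proof -
    have "\<exists>h. Q m z h"
      using measurable_approx_subgradient[OF borel_measurable_integrable[OF f]
          borel_measurable_integrable[OF L] cvx lip, of "1 / real m" z] m
      unfolding Q_def Bex_def by simp
    then show ?thesis unfolding g_def by (rule someI_ex)
  qed
  have g: "g m z \<in> borel_measurable \<mu>"
    "e \<in> space \<mu> \<Longrightarrow> norm (g m z e) \<le> L e + 1"
    "e \<in> space \<mu> \<Longrightarrow> f e z + inner (g m z e) (y - z) - 1 / real m * (1 + dist y z) \<le> f e y"
    if m: "m \<ge> 1" for m z e y
    using Q[OF m, of z] unfolding Q_def by auto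
  have g_int: "integrable \<mu> (g m z)" if "m \<ge> 1" for m z
  proof (rule Bochner_Integration.integrable_bound)
    show "integrable \<mu> (\<lambda>e. L e + 1)" using L by simp
    show "g m z \<in> borel_measurable \<mu>" using g(1) that .
    have "norm (g m z e) \<le> norm (L e + 1)" if "e \<in> space \<mu>" for e
      using g(2)[OF \<open>m \<ge> 1\<close> that, of z] L0[OF that] by simp
    then show "AE e in \<mu>. norm (g m z e) \<le> norm (L e + 1)" by (rule AE_I2)
  qed
  define G where "G m z = integral\<^sup>L \<mu> (g m z)" for m z
  have G: "norm (G m z) \<le> C" if m: "m \<ge> 1" for m z
  proof -
    have "norm (G m z) \<le> (\<integral>e. norm (g m z e) \<partial>\<mu>)" unfolding G_def by (rule integral_norm_bound)
    also have "\<dots> \<le> (\<integral>e. L e + 1 \<partial>\<mu>)"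
      using g(2)[OF m] g_int[OF m] L by (intro integral_mono) auto
    also have "\<dots> = \<Lambda> + 1" using L by (simp add: \<Lambda>_def \<mu>.prob_space)
    finally show ?thesis using \<Lambda>0 by (simp add: C_def)
  qed
  \<comment> \<open>Integrating the pointwise inequalities makes \<open>G m z\<close> an approximate
    subgradient of \<open>F\<close>, so the deterministic iterates can use the same
    directions.\<close>
  have G_sub: "F z + inner (G m z) (y - z) - 1 / real m * (1 + dist y z) \<le> F y" if m: "m \<ge> 1" for m z y
  proof -
    have "(\<integral>e. f e z + inner (g m z e) (y - z) - 1 / real m * (1 + dist y z) \<partial>\<mu>) \<le> F y"
      unfolding F_def using g(3)[OF m] g_int[OF m] f by (intro integral_mono) auto
    then show ?thesis using g_int[OF m, of z] f by (simp add: F_def G_def \<mu>.prob_space)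
  qed
  have F: "convex_on UNIV F" "\<Lambda>-lipschitz_on UNIV F"
    unfolding F_def \<Lambda>_def using cvx lip L f by (auto intro: convex_on_integral lipschitz_on_integral)
  have flow: "consistent_scheme D G C t (\<lambda>N k. (prox (t / real N) (\<lambda>y. ereal (F y)) ^^ k) x)" if "t > 0" for t x
  proof -
    have "consistent_scheme D G C t
       (\<lambda>N k. (prox_cycle (t / real N / real 1) 1 (\<lambda>i y. ereal (F y)) ^^ k) x)"
      using that F G_sub \<Lambda>0
      by (intro consistent_scheme_prox_cycle[where \<nu>="\<lambda>_. 1" and \<phi>="\<lambda>_. F" and L="\<lambda>_. \<Lambda>" and \<gamma>="\<lambda>m z _. G m z"])
        (auto simp: C_def)
    moreover have "prox_cycle r 1 (\<lambda>i y. ereal (F y)) = prox r (\<lambda>y. ereal (F y))" for r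
      by (simp add: prox_cycle_def fun_eq_iff)
    ultimately show ?thesis by simp
  qed
  have "AE \<omega> in M. \<forall>\<^sub>F n in sequentially. (\<Sum>i=1..n. L (\<xi> i \<omega>)) \<le> real n * C"
    unfolding C_def \<Lambda>_def by (rule strong_law_upper_bound) (use L L0 in auto)
  moreover have "AE \<omega> in M. \<forall>m\<in>{1..}. \<forall>z\<in>D.
      (\<lambda>n. (1 / real n) *\<^sub>R (\<Sum>i=1..n. g m z (\<xi> i \<omega>))) \<longlonglongrightarrow> G m z"
    unfolding G_def by (intro AE_ball_countable' strong_law g_int D) auto
  ultimately show ?thesis
  proof (rule AE_mp[OF AE_conjI], intro AE_I2 impI allI)
    fix \<omega> and t :: real and x
    assume \<omega>: "\<omega> \<in> space M" and t: "t > 0"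
    assume good: "(\<forall>\<^sub>F n in sequentially. (\<Sum>i=1..n. L (\<xi> i \<omega>)) \<le> real n * C) \<and>
      (\<forall>m\<in>{1..}. \<forall>z\<in>D. (\<lambda>n. (1 / real n) *\<^sub>R (\<Sum>i=1..n. g m z (\<xi> i \<omega>))) \<longlonglongrightarrow> G m z)"
    have \<xi>: "\<xi> i \<omega> \<in> space \<mu>" if "i \<ge> 1" for i
      using rv[OF that] \<omega> by (rule measurable_space)
    have "consistent_scheme D G C t (\<lambda>N k.
        (prox_cycle (t / real N / real N) N (\<lambda>i y. ereal (f (\<xi> i \<omega>) y)) ^^ k) x)"
    proof (rule consistent_scheme_prox_cycle[where \<nu>="\<lambda>N. N" and L="\<lambda>i. L (\<xi> i \<omega>)" and \<gamma>="\<lambda>m z i. g m z (\<xi> i \<omega>)"])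
      fix m z assume m: "m \<ge> (1::nat)" and z: "z \<in> D"
      then have "(\<lambda>n. (1 / real n) *\<^sub>R (\<Sum>i=1..n. g m z (\<xi> i \<omega>))) \<longlonglongrightarrow> G m z" using good by auto
      then have "\<forall>\<^sub>F n in sequentially. dist ((1 / real n) *\<^sub>R (\<Sum>i=1..n. g m z (\<xi> i \<omega>))) (G m z) < 1 / real m"
        using m by (intro tendstoD) auto
      then show "\<forall>\<^sub>F n in sequentially.
          norm ((1 / real n) *\<^sub>R (\<Sum>i=1..n. g m z (\<xi> i \<omega>)) - G m z) \<le> 1 / real m"
        by eventually_elim (simp add: dist_norm)
    qed (use t good \<xi> cvx lip g(3) in auto)
    from consistent_schemes_converge[OF t _ clD G this _ flow[OF t, of x]]
    show "\<exists>p. (\<lambda>n. (prox_cycle (t / (real n)\<^sup>2) n (\<lambda>i y. ereal (f (\<xi> i \<omega>) y)) ^^ n) x) \<longlonglongrightarrow> p \<and>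
      (\<lambda>n. (prox (t / real n) (\<lambda>y. ereal (\<integral>e. f e y \<partial>\<mu>)) ^^ n) x) \<longlonglongrightarrow> p"
      using \<Lambda>0 by (simp add: power2_eq_square F_def C_def)
  qed
qed

section \<open>Reduction of the extended-real statement to real-valued integrands\<close>

theorem theorem7p8:
  fixes P :: "'w measure" and \<mu> :: "'e measure"
    and \<xi> :: "nat \<Rightarrow> 'w \<Rightarrow> 'e"
    and f :: "'e \<Rightarrow> 'h::{real_inner, banach, second_countable_topology} \<Rightarrow> ereal"
    and S :: "real \<Rightarrow> 'h \<Rightarrow> 'h"
  assumes "prob_space P" and "prob_space \<mu>" and "complete_measure \<mu>"
    and "iid_with_law P \<mu> \<xi>"
    and "normal_convex_integrand \<mu> f" and "proper_integrand \<mu> f"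
    and "L1_Lipschitz \<mu> f"
    and "\<exists>u0. L1_real \<mu> (\<lambda>e. f e u0)"
  defines "S \<equiv> gradient_flow (\<lambda>x. ereal_integral \<mu> (\<lambda>e. f e x))"
  shows "(\<exists>\<Omega>'. \<Omega>' \<in> sets P \<and> measure P \<Omega>' = 1 \<and>
            (\<forall>\<omega>\<in>\<Omega>'. \<forall>t\<ge>0. \<forall>x.
               (\<lambda>n. (prox_cycle (t / (real n)\<^sup>2) n (\<lambda>i. f (\<xi> i \<omega>)) ^^ n) x)
                 \<longlonglongrightarrow> S t x)) \<and>
         (\<forall>t\<ge>0. \<forall>x. AE \<omega> in P.
            (\<lambda>n. (prox_cycle (t / (real n)\<^sup>2) n (\<lambda>i. f (\<xi> i \<omega>)) ^^ n) x)
              \<longlonglongrightarrow> S t x)"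
proof -
  interpret P: prob_space P by fact
  let ?Conv = "\<lambda>\<omega> t x. (\<lambda>n. (prox_cycle (t / (real n)\<^sup>2) n (\<lambda>i. f (\<xi> i \<omega>)) ^^ n) x) \<longlonglongrightarrow> S t x"
  obtain L where L: "integrable \<mu> L" "\<And>e. e \<in> space \<mu> \<Longrightarrow> 0 < L e"
    "\<And>e x y. e \<in> space \<mu> \<Longrightarrow> \<bar>f e x - f e y\<bar> \<le> ereal (L e * dist x y)"
    using assms(7) unfolding L1_Lipschitz_def by blast
  define g where "g e y = real_of_ereal (f e y)" for e y
  \<comment> \<open>The Lipschitz bound at two equal points forces finiteness, as
    \<open>\<infinity> - \<infinity>\<close> is \<open>\<infinity>\<close>.\<close>
  have fg: "f e y = ereal (g e y)" if "e \<in> space \<mu>" for e y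
    using finite_if_dominated_self_difference[OF L(3)[OF that, of y y]] by (simp add: g_def ereal_real')
  have lip: "(L e)-lipschitz_on UNIV (g e)" if e: "e \<in> space \<mu>" for e
    using L(2)[OF e] L(3)[OF e] by (intro lipschitz_onI) (auto simp: fg[OF e] dist_real_def)
  have cvx: "convex_on UNIV (g e)" if e: "e \<in> space \<mu>" for e
  proof (rule convex_on_if_convex_fun)
    have "convex_fun (f e)" using assms(5) e unfolding normal_convex_integrand_def by blast
    moreover have "f e = (\<lambda>x. ereal (g e x))" using fg[OF e] by auto
    ultimately show "convex_fun (\<lambda>x. ereal (g e x))" by simp
  qed
  have meas [measurable]: "(\<lambda>e. g e y) \<in> borel_measurable \<mu>" for y
    using assms(5) fg unfolding normal_convex_integrand_def
    by (blast intro: borel_measurable_if_normal_integrand)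
  \<comment> \<open>Integrability at one point spreads to every \<open>y\<close> through the
    integrable Lipschitz bound.\<close>
  have int: "integrable \<mu> (\<lambda>e. g e y)" for y
  proof -
    obtain u where u: "integrable \<mu> (\<lambda>e. g e u)"
      using assms(8) unfolding L1_real_def g_def by blast
    have "integrable \<mu> (\<lambda>e. g e y - g e u)"
    proof (rule Bochner_Integration.integrable_bound)
      show "integrable \<mu> (\<lambda>e. L e * dist y u)" using L(1) by simp
      show "AE e in \<mu>. norm (g e y - g e u) \<le> norm (L e * dist y u)"
        using lipschitz_onD[OF lip, of _ y u] L(2)
        by (intro AE_I2) (force simp: dist_norm abs_mult less_imp_le)
    qed measurable
    from Bochner_Integration.integrable_add[OF this u] show ?thesis by simp
  qed
  have S0: "S 0 x = x" for x by (simp add: S_def gradient_flow_def)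
  have S: "S t x = lim (\<lambda>k. (prox (t / real k) (\<lambda>y. ereal (\<integral>e. g e y \<partial>\<mu>)) ^^ k) x)" if "t > 0" for t x
    using that by (simp add: S_def gradient_flow_def ereal_integral_eq_integral[OF fg int])
  have "AE \<omega> in P. \<forall>t\<ge>0. \<forall>x. ?Conv \<omega> t x"
  proof (rule AE_mp[OF P.prox_cycle_iterates_converge[OF assms(4) cvx lip L(1) int]],
      assumption, assumption, intro AE_I2 impI allI)
    fix \<omega> and t :: real and x
    assume \<omega>: "\<omega> \<in> space P" and t: "t \<ge> 0"
    assume conv: "\<forall>t>0. \<forall>x. \<exists>p.
      (\<lambda>n. (prox_cycle (t / (real n)\<^sup>2) n (\<lambda>i y. ereal (g (\<xi> i \<omega>) y)) ^^ n) x) \<longlonglongrightarrow> p \<and>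
      (\<lambda>n. (prox (t / real n) (\<lambda>y. ereal (\<integral>e. g e y \<partial>\<mu>)) ^^ n) x) \<longlonglongrightarrow> p"
    show "?Conv \<omega> t x"
    proof (cases "t = 0")
      case True
      \<comment> \<open>A step of size 0 is the identity by definition, matching \<open>S 0\<close>;
        the convergence result covers only \<open>t > 0\<close>.\<close>
      have "prox_cycle 0 n h = id" for n and h :: "nat \<Rightarrow> 'h \<Rightarrow> ereal"
      proof -
        have "fold (\<lambda>i. prox 0 (h i)) js = id" for js
          by (induction js) (auto simp: prox_def fun_eq_iff)
        then show ?thesis unfolding prox_cycle_def .
      qed
      then show ?thesis using True by (simp add: S0)
    next
      case False
      have "\<xi> i \<omega> \<in> space \<mu>" if "i \<ge> 1" for i
        using assms(4) that \<omega> unfolding iid_with_law_def P.indep_vars_def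
        by (auto intro: measurable_space)
      then have f_eq: "f (\<xi> i \<omega>) = (\<lambda>y. ereal (g (\<xi> i \<omega>) y))" if "i \<ge> 1" for i
        using fg that by blast
      \<comment> \<open>The cycle uses indices from 1 on, exactly those for which
        \<open>\<xi> i \<omega>\<close> is known to lie in \<open>space \<mu>\<close>.\<close>
      have "prox_cycle c n (\<lambda>i. f (\<xi> i \<omega>)) = prox_cycle c n (\<lambda>i y. ereal (g (\<xi> i \<omega>) y))" for c n
        unfolding prox_cycle_def by (intro ext fold_cong) (auto simp: f_eq)
      moreover obtain p where
        "(\<lambda>n. (prox_cycle (t / (real n)\<^sup>2) n (\<lambda>i y. ereal (g (\<xi> i \<omega>) y)) ^^ n) x) \<longlonglongrightarrow> p"
        "(\<lambda>n. (prox (t / real n) (\<lambda>y. ereal (\<integral>e. g e y \<partial>\<mu>)) ^^ n) x) \<longlonglongrightarrow> p"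
        using conv[rule_format, of t x] False t by auto
      moreover from this(2) have "S t x = p" using False t by (simp add: S limI)
      ultimately show ?thesis by simp
    qed
  qed
  \<comment> \<open>A measurable null superset \<open>Z\<close> is removed, since the exceptional
    set itself is not known to be measurable.\<close>
  then obtain Z where Z: "{\<omega> \<in> space P. \<not> (\<forall>t\<ge>0. \<forall>x. ?Conv \<omega> t x)} \<subseteq> Z" "emeasure P Z = 0" "Z \<in> sets P"
    by (rule AE_E)
  have "P.prob (space P - Z) = 1"
    unfolding P.prob_compl[OF Z(3)] using Z(2) by (simp add: measure_def)
  moreover have "\<forall>\<omega>\<in>space P - Z. \<forall>t\<ge>0. \<forall>x. ?Conv \<omega> t x" using Z(1) by blast
  moreover have "\<forall>t\<ge>0. \<forall>x. AE \<omega> in P. ?Conv \<omega> t x"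
    using \<open>AE \<omega> in P. \<forall>t\<ge>0. \<forall>x. ?Conv \<omega> t x\<close> by (auto elim: eventually_mono)
  ultimately show ?thesis using Z(3) by blast
qed

end
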